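(* Consider spatially uncorrelated channels with imperfect channel estimation, as described in the context, and the spatial-suppression precoder $\bar{\boldsymbol{G}}_{\mathrm{sps}}=(g_{km,\mathrm{sps}})$ built from the estimated channels. Write $E_{nm}$ for the $(n,m)$-th entry of the self-interference channel estimation error matrix $\boldsymbol{E}_{\mathrm{SI}}$. Then for all $1\le i\le N$, $1\le k\le M$, $1\le m\le K_{\mathrm{DL}}$, $$\zeta_{\mathrm{sps}}:=\mathrm{Cov}(|E_{ik}|^2,|g_{km,\mathrm{sps}}|^2)+\sum_{\ell=1,\,\ell\neq k}^{M}\mathbb{E}\{E_{ik}E_{i\ell}^*\,g_{km,\mathrm{sps}}\,g_{\ell m,\mathrm{sps}}^*\}\le 0 .$$
   Context: Let $M,N,K_{\mathrm{DL}}\ge1$ be integers with $M\ge N+K_{\mathrm{DL}}$. For a scalar, $a^*$ is the complex conjugate; for a matrix, $\boldsymbol{A}^*$ is the conjugate transpose. $\mathcal{CN}(0,\sigma^2)$ is the circularly symmetric complex Gaussian distribution with mean $0$ and variance $\sigma^2$. Channels (uncorrelated case): $\boldsymbol{H}_{\mathrm{DL}}$ is a random $K_{\mathrm{DL}}\times M$ matrix and $\boldsymbol{H}_{\mathrm{SI}}$ a random $N\times M$ matrix, each with i.i.d. $\mathcal{CN}(0,1)$ entries. Estimation: $\hat{\boldsymbol{H}}_{\mathrm{DL}}=\boldsymbol{H}_{\mathrm{DL}}+\boldsymbol{E}_{\mathrm{DL}}$ and $\hat{\boldsymbol{H}}_{\mathrm{SI}}=\boldsymbol{H}_{\mathrm{SI}}+\boldsymbol{E}_{\mathrm{SI}}$,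 where the entries of $\boldsymbol{E}_{\mathrm{DL}}$ are independent, those in row $k_{\mathrm d}$ being $\mathcal{CN}(0,\epsilon_{\mathrm{DL},k_{\mathrm d}}^2)$, and the entries of $\boldsymbol{E}_{\mathrm{SI}}$ are i.i.d. $\mathcal{CN}(0,\epsilon_{\mathrm{SI}}^2)$ with $\epsilon_{\mathrm{SI}}>0$. The matrices $\boldsymbol{H}_{\mathrm{DL}},\boldsymbol{H}_{\mathrm{SI}},\boldsymbol{E}_{\mathrm{DL}},\boldsymbol{E}_{\mathrm{SI}}$ are mutually independent. Spatial-suppression precoder: put $\hat{\boldsymbol{H}}_{\mathrm{ext}}=\begin{bmatrix}\hat{\boldsymbol{H}}_{\mathrm{DL}}\\ \hat{\boldsymbol{H}}_{\mathrm{SI}}\end{bmatrix}$ (size $(K_{\mathrm{DL}}+N)\times M$) and let $\boldsymbol{f}_1,\dots,\boldsymbol{f}_{K_{\mathrm{DL}}}$ be the first $K_{\mathrm{DL}}$ columns of $\hat{\boldsymbol{H}}_{\mathrm{ext}}^*(\hat{\boldsymbol{H}}_{\mathrm{ext}}\hat{\boldsymbol{H}}_{\mathrm{ext}}^* )^{-1}$ (defined almost surely). Then $\bar{\boldsymbol{G}}_{\mathrm{sps}}$ is the $M\times K_{\mathrm{DL}}$ matrix whose $m$-th column is $\boldsymbol{f}_m/(\sqrt{K_{\mathrm{DL}}}\,\|\boldsymbol{f}_m\|)$, and $g_{km,\mathrm{sps}}$ is its $(k,m)$-th entry; in particular $\hat{\boldsymbol{H}}_{\mathrm{SI}}\bar{\boldsymbol{G}}_{\mathrm{sps}}=\boldsymbol{0}$.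 *)

theory Defs
  imports "HOL-Probability.Probability" "HOL-Library.Complex_Order"
begin

text \<open>
  Matrix dimensions are index types: \<open>complex ^ 'c ^ 'r\<close> is the type of matrices with
  \<open>CARD('r)\<close> rows and \<open>CARD('c)\<close> columns, and \<open>A $ r $ c\<close> is the entry in row \<open>r\<close>, column \<open>c\<close>.
  The order on \<open>complex\<close> is that of \<^theory>\<open>HOL-Library.Complex_Order\<close>: \<open>z \<le> 0\<close> means that
  \<open>z\<close> is real and nonpositive.
\<close>

text \<open>
  The law of \<open>sqrt (v/2) * (X + \<i> Y)\<close> for independent standard normal \<open>X\<close>, \<open>Y\<close>, i.e. the circularly
  symmetric complex Gaussian law with mean \<open>0\<close> and variance \<open>v \<ge> 0\<close>.
  Being a push-forward, it is also correct for \<open>v = 0\<close>, where it is the point mass at \<open>0\<close>.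
\<close>

definition CN :: "real \<Rightarrow> complex measure" where
  "CN v = distr (std_normal_distribution \<Otimes>\<^sub>M std_normal_distribution) borel
            (\<lambda>(x, y). complex_of_real (sqrt (v / 2)) * Complex x y)"

definition indep_CN_entries ::
  "'a measure \<Rightarrow> ('a \<Rightarrow> complex ^ 'c::finite ^ 'r::finite) \<Rightarrow> ('r \<Rightarrow> real) \<Rightarrow> bool" where
  "indep_CN_entries P X v \<longleftrightarrow>
     prob_space.indep_vars P (\<lambda>_. borel) (\<lambda>(r, c) \<omega>. X \<omega> $ r $ c) UNIV \<and>
     (\<forall>r c. distr P borel (\<lambda>\<omega>. X \<omega> $ r $ c) = CN (v r))"

definition events_of :: "'a measure \<Rightarrow> ('a \<Rightarrow> 'b::topological_space) \<Rightarrow> 'a set set" where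
  "events_of P X = {X -` B \<inter> space P | B. B \<in> sets borel}"

definition covariance :: "'a measure \<Rightarrow> ('a \<Rightarrow> real) \<Rightarrow> ('a \<Rightarrow> real) \<Rightarrow> real" where
  "covariance P X Y =
     integral\<^sup>L P (\<lambda>\<omega>. (X \<omega> - integral\<^sup>L P X) * (Y \<omega> - integral\<^sup>L P Y))"

definition conj_transpose :: "complex ^ 'c::finite ^ 'r::finite \<Rightarrow> complex ^ 'r ^ 'c" where
  "conj_transpose A = (\<chi> i j. cnj (A $ j $ i))"

definition stack_rows :: "'x ^ 'c ^ 'r::finite \<Rightarrow> 'x ^ 'c ^ 's::finite \<Rightarrow> 'x ^ 'c ^ ('r + 's)" where
  "stack_rows A B = (\<chi> r. case r of Inl i \<Rightarrow> A $ i | Inr j \<Rightarrow> B $ j)"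

definition right_pseudo_inverse :: "complex ^ 'c::finite ^ 'r::finite \<Rightarrow> complex ^ 'r ^ 'c" where
  "right_pseudo_inverse H = conj_transpose H ** matrix_inv (H ** conj_transpose H)"

text \<open>
  The columns of the pseudo-inverse of the stacked matrix are indexed by \<open>'d + 'n\<close>; its first
  \<open>CARD('d)\<close> columns are those with index \<open>Inl m\<close>.  The value is meaningful when the Gram matrix
  is invertible; otherwise \<^const>\<open>matrix_inv\<close> is an unspecified matrix.
\<close>

definition sps_precoder ::
  "complex ^ 'm::finite ^ 'd::finite \<Rightarrow> complex ^ 'm ^ 'n::finite \<Rightarrow> complex ^ 'd ^ 'm" where
  "sps_precoder H_DL H_SI =
     (\<chi> k m. let f = column (Inl m) (right_pseudo_inverse (stack_rows H_DL H_SI))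
             in f $ k / complex_of_real (sqrt (real CARD('d)) * norm f))"

end

theory Submission
  imports Defs "HOL-Computational_Algebra.Polynomial"
begin

text \<open>
  Let \<open>v\<close> be the error variance and \<open>c = v / (1 + v)\<close>, and let \<open>e\<close> and \<open>y = h + e\<close> be the \<open>i\<close>-th rows of
  the error and of the estimated self-interference channel. The regression residual \<open>w = e - c y\<close> is
  independent of all estimated channels, hence of the precoder column \<open>g\<close>. Almost surely \<open>y g = 0\<close>, so
  \<open>e g = w g\<close>. Completing the sum by the term \<open>l = k\<close> thus turns it into the expectation of
  \<open>(c y\<^sub>k + w\<^sub>k) g\<^sub>k (w g)\<^sup>*\<close>, which is \<open>s\<close> times that of \<open>\<bar>g\<^sub>k\<bar>\<^sup>2\<close>, where \<open>s = c\<close> is the variance of \<open>w\<^sub>k\<close>.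
  Hence the quantity in question is \<open>s - v \<le> 0\<close> times the expectation of \<open>\<bar>g\<^sub>k\<bar>\<^sup>2\<close>.
\<close>

section \<open>Densities of complex Gaussian matrices\<close>

text \<open>The value of \<open>c\<close> is forced: an entry of \<open>y\<close> has variance
  \<open>1 + v\<close> and covariance \<open>v\<close> with the matching entry of \<open>e\<close>,
  so only \<open>c = v / (1 + v)\<close> makes \<open>e - c y\<close> and \<open>y\<close>
  uncorrelated, which for jointly Gaussian variables means independent. Since the precoder is a
  nonlinear function of all estimated rows, this independence is needed for whole matrices; it is
  read off a factorisation of the joint density. In the completed expectation the part with
  \<open>c\<close> vanishes because \<open>w\<close> is centred, and in the other part only
  \<open>l = k\<close> survives because distinct entries of \<open>w\<close> are uncorrelated. Row
  variances of the downlink error may be 0, so that error need not have a density. Almost sure full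
  rank therefore comes from the density of the true channels, with the errors acting as an
  independent shift. Expectations are split and rearranged throughout, which requires integrability;
  it rests on measurability of the precoder, including its values at singular Gram matrices, and on
  the bound 1 for its entries.\<close>

lemma distr_Complex_lborel: "distr lborel borel (\<lambda>(x, y). Complex x y) = (lborel :: complex measure)"
proof (rule lborel_eqI[symmetric])
  fix l u :: complex
  assume le: "\<And>b. b \<in> Basis \<Longrightarrow> l \<bullet> b \<le> u \<bullet> b"
  have "(\<lambda>(x, y). Complex x y) -` box l u = box (Re l) (Re u) \<times> box (Im l) (Im u)"
    by (auto simp: box_def Basis_complex_def inner_complex_def)
  moreover have "Re l \<le> Re u" "Im l \<le> Im u"
    using le[of 1] le[of \<i>] by (auto simp: Basis_complex_def inner_complex_def)
  moreover have "(\<lambda>(x, y). Complex x y) \<in> borel_measurable (lborel \<Otimes>\<^sub>M lborel)"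
    by (simp add: Complex_eq split_beta')
  ultimately show "emeasure (distr lborel borel (\<lambda>(x, y). Complex x y)) (box l u)
      = ennreal (\<Prod>b\<in>Basis. (u - l) \<bullet> b)"
    by (simp add: lborel_prod[symmetric] emeasure_distr space_pair_measure
        lborel.emeasure_pair_measure_Times Basis_complex_def inner_complex_def ennreal_mult)
qed simp

text \<open>The product of two standard normal densities depends on the modulus only, so scaling by
  \<open>s\<close> keeps its shape and contributes the Jacobian \<open>s^2 = v / 2\<close> of a real
  two-dimensional map.\<close>

lemma CN_eq_density:
  assumes "v > 0"
  shows "CN v = density lborel (\<lambda>z. ennreal (exp (- (cmod z)\<^sup>2 / v) / (pi * v)))"
proof -
  define s where "s = sqrt (v / 2)"
  have s: "s > 0" "s\<^sup>2 = v / 2"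
    using assms by (auto simp: s_def)
  \<comment> \<open>\<open>h\<close> is written in the variable after scaling: at \<open>s\<close>
    times \<open>z\<close> it equals the planar standard normal density at \<open>z\<close>. This is
    the form in which a density passes through a push-forward.\<close>
  define h where "h = (\<lambda>z::complex. ennreal (exp (- (cmod z)\<^sup>2 / v) / (2 * pi)))"
  have [measurable]: "h \<in> borel_measurable borel"
    unfolding h_def by measurable
  have [measurable]: "(\<lambda>(x, y). Complex x y) \<in> borel_measurable borel"
    by (simp add: Complex_eq split_beta' borel_prod[symmetric])
  interpret N: prob_space std_normal_distribution
    by (rule prob_space_normal_density) simp
  have "std_normal_distribution \<Otimes>\<^sub>M std_normal_distribution
      = density (lborel \<Otimes>\<^sub>M lborel)
          (\<lambda>(x, y). ennreal (std_normal_density x) * ennreal (std_normal_density y))"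
    by (rule pair_measure_density) (auto intro: lborel.sigma_finite_measure_axioms N.sigma_finite_measure_axioms)
  also have "(\<lambda>(x, y). ennreal (std_normal_density x) * ennreal (std_normal_density y))
      = (\<lambda>p. h (s *\<^sub>R (case p of (x, y) \<Rightarrow> Complex x y)))"
  proof (rule ext, clarify)
    fix x y :: real
    have "cmod (s *\<^sub>R Complex x y) ^ 2 = v / 2 * (x\<^sup>2 + y\<^sup>2)"
      using s by (simp add: power_mult_distrib cmod_power2)
    then have "- (cmod (s *\<^sub>R Complex x y))\<^sup>2 / v = - x\<^sup>2 / 2 + - y\<^sup>2 / 2"
      using assms by (simp add: field_simps)
    then have "h (s *\<^sub>R Complex x y) = ennreal (exp (- x\<^sup>2 / 2) * exp (- y\<^sup>2 / 2) / (2 * pi))"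
      unfolding h_def by (simp only: exp_add)
    also have "exp (- x\<^sup>2 / 2) * exp (- y\<^sup>2 / 2) / (2 * pi) = std_normal_density x * std_normal_density y"
      by (simp add: std_normal_density_def field_simps)
    finally show "ennreal (std_normal_density x) * ennreal (std_normal_density y)
        = h (s *\<^sub>R Complex x y)"
      by (simp add: ennreal_mult)
  qed
  finally have "CN v = distr (density lborel (\<lambda>p. h (s *\<^sub>R (case p of (x, y) \<Rightarrow> Complex x y)))) borel
      (\<lambda>p. s *\<^sub>R (case p of (x, y) \<Rightarrow> Complex x y))"
    unfolding CN_def s_def[symmetric] by (simp add: lborel_prod split_beta' scaleR_conv_of_real)
  also have "\<dots> = density (distr lborel borel (\<lambda>p. s *\<^sub>R (case p of (x, y) \<Rightarrow> Complex x y))) h"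
    by (subst density_distr) auto
  also have "distr lborel borel (\<lambda>p. s *\<^sub>R (case p of (x, y) \<Rightarrow> Complex x y))
      = distr (distr lborel borel (\<lambda>(x, y). Complex x y)) borel (\<lambda>z. s *\<^sub>R z)"
    by (subst distr_distr) (auto simp: comp_def)
  \<comment> \<open>Splitting off the Jacobian:
    \<open>1 / (2 * pi) = (v / 2) * (1 / (pi * v))\<close>, and the factor \<open>v / 2\<close> is
    what \<open>lborel_affine\<close> absorbs.\<close>
  also have "\<dots> = distr lborel borel (\<lambda>z. 0 + s *\<^sub>R z)"
    by (simp add: distr_Complex_lborel)
  also have "density \<dots> h = density (density (distr lborel borel (\<lambda>z. 0 + s *\<^sub>R z)) (\<lambda>_. ennreal (\<bar>s\<bar> ^ DIM(complex))))
      (\<lambda>z. ennreal (exp (- (cmod z)\<^sup>2 / v) / (pi * v)))"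
  proof (subst density_density_eq)
    show "density (distr lborel borel (\<lambda>z. 0 + s *\<^sub>R z)) h =
      density (distr lborel borel (\<lambda>z. 0 + s *\<^sub>R z))
        (\<lambda>z. ennreal (\<bar>s\<bar> ^ DIM(complex)) * ennreal (exp (- (cmod z)\<^sup>2 / v) / (pi * v)))"
      using assms by (intro density_cong AE_I2) (simp_all add: h_def ennreal_mult[symmetric] s)
  qed simp_all
  also have "\<dots> = density lborel (\<lambda>z. ennreal (exp (- (cmod z)\<^sup>2 / v) / (pi * v)))"
    using s by (subst lborel_affine[symmetric]) auto
  finally show ?thesis .
qed

text \<open>A product measure is determined by its values on boxes; there the integrand is a product
  of one-variable functions and the integral factors.\<close>

lemma (in product_sigma_finite) PiM_density:
  assumes "finite I" and f[measurable]: "\<And>i. f i \<in> borel_measurable (M i)"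
    and sf: "\<And>i. sigma_finite_measure (density (M i) (f i))"
  shows "(\<Pi>\<^sub>M i\<in>I. density (M i) (f i)) = density (PiM I M) (\<lambda>x. \<Prod>i\<in>I. f i (x i))"
proof (rule sym, rule product_sigma_finite.PiM_eqI)
  show "product_sigma_finite (\<lambda>i. density (M i) (f i))"
    unfolding product_sigma_finite_def using sf by simp
  show "finite I" by fact
  show "sets (density (PiM I M) (\<lambda>x. \<Prod>i\<in>I. f i (x i))) = sets (\<Pi>\<^sub>M i\<in>I. density (M i) (f i))"
    by (simp cong: sets_PiM_cong)
  fix A assume "\<And>i. i \<in> I \<Longrightarrow> A i \<in> sets (density (M i) (f i))"
  then have A[measurable]: "\<And>i. i \<in> I \<Longrightarrow> A i \<in> sets (M i)"
    by simp
  have "emeasure (density (PiM I M) (\<lambda>x. \<Prod>i\<in>I. f i (x i))) (Pi\<^sub>E I A)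
      = (\<integral>\<^sup>+x. (\<Prod>i\<in>I. f i (x i)) * indicator (Pi\<^sub>E I A) x \<partial>PiM I M)"
    using \<open>finite I\<close> A by (subst emeasure_density) (auto intro!: sets_PiM_I_finite)
  also have "\<dots> = (\<integral>\<^sup>+x. (\<Prod>i\<in>I. f i (x i) * indicator (A i) (x i)) \<partial>PiM I M)"
  proof (rule nn_integral_cong)
    fix x assume "x \<in> space (PiM I M)"
    then have "indicator (Pi\<^sub>E I A) x = (\<Prod>i\<in>I. indicator (A i) (x i) :: ennreal)"
      using \<open>finite I\<close> by (auto simp: indicator_def space_PiM PiE_iff prod_zero_iff)
    then show "(\<Prod>i\<in>I. f i (x i)) * indicator (Pi\<^sub>E I A) x = (\<Prod>i\<in>I. f i (x i) * indicator (A i) (x i))"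
      by (simp add: prod.distrib)
  qed
  also have "\<dots> = (\<Prod>i\<in>I. \<integral>\<^sup>+x. f i x * indicator (A i) x \<partial>M i)"
    using \<open>finite I\<close> A by (intro product_nn_integral_prod) auto
  also have "\<dots> = (\<Prod>i\<in>I. emeasure (density (M i) (f i)) (A i))"
    using A by (intro prod.cong) (auto simp: emeasure_density)
  finally show "emeasure (density (PiM I M) (\<lambda>x. \<Prod>i\<in>I. f i (x i))) (Pi\<^sub>E I A)
      = (\<Prod>i\<in>I. emeasure (density (M i) (f i)) (A i))" .
qed

lemma prod_Basis_vec:
  fixes g :: "'a::euclidean_space ^ 'n::finite \<Rightarrow> 'b::comm_monoid_mult"
  shows "(\<Prod>b\<in>Basis. g b) = (\<Prod>i\<in>UNIV. \<Prod>u\<in>Basis. g (axis i u))"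
proof -
  have "(\<Prod>b\<in>Basis. g b) = (\<Prod>i\<in>UNIV. \<Prod>b\<in>(\<lambda>u::'a. axis i u :: 'a ^ 'n) ` Basis. g b)"
    unfolding Basis_vec_def
    by (subst prod.UNION_disjoint[symmetric])
       (auto simp: axis_eq_axis intro!: prod.cong)
  also have "\<dots> = (\<Prod>i\<in>UNIV. \<Prod>u\<in>Basis. g (axis i u :: 'a ^ 'n))"
    by (intro prod.cong refl prod.reindex_cong[OF _ refl]) (auto simp: inj_on_def axis_eq_axis)
  finally show ?thesis .
qed

lemma measurable_vec_lambda[measurable (raw)]:
  fixes f :: "'b \<Rightarrow> 'n::finite \<Rightarrow> 'a::euclidean_space"
  assumes "\<And>i. (\<lambda>x. f x i) \<in> borel_measurable M"
  shows "(\<lambda>x. \<chi> i. f x i) \<in> borel_measurable M"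
proof (subst borel_measurable_euclidean_space, safe)
  fix b :: "'a ^ 'n" assume "b \<in> Basis"
  then show "(\<lambda>x. (\<chi> i. f x i) \<bullet> b) \<in> borel_measurable M"
    using assms by (auto simp: Basis_vec_def inner_axis)
qed

lemma measurable_vec_nth[measurable]: "(\<lambda>x. x $ i) \<in> borel_measurable borel"
  for i :: "'n::finite"
  by (rule borel_measurable_continuous_onI) (auto intro: continuous_intros)

text \<open>Passes from products over index pairs, where independence of the entries lives, to
  Lebesgue measure on the matrix space. Both sides give a box the product of its side
  lengths.\<close>

lemma distr_PiM_lborel_matrix:
  "distr (\<Pi>\<^sub>M _\<in>(UNIV::('r::finite \<times> 'c::finite) set). lborel) borel (\<lambda>f. \<chi> r c. f (r, c))
     = (lborel :: ('a::euclidean_space ^ 'c ^ 'r) measure)"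
proof (rule lborel_eqI[symmetric])
  fix l u :: "'a ^ 'c ^ 'r"
  assume le: "\<And>b. b \<in> Basis \<Longrightarrow> l \<bullet> b \<le> u \<bullet> b"
  interpret product_sigma_finite "\<lambda>_::'r \<times> 'c. lborel :: 'a measure" ..
  have le': "l $ r $ c \<bullet> b \<le> u $ r $ c \<bullet> b" if "b \<in> Basis" for r c b
    using le[of "axis r (axis c b)"] that by (auto simp: inner_axis Basis_vec_def)
  have "(\<lambda>f. \<chi> r c. f (r, c)) -` box l u = (\<Pi>\<^sub>E p\<in>UNIV. box (l $ fst p $ snd p) (u $ fst p $ snd p))"
    by (auto simp: set_eq_iff PiE_iff box_def Basis_vec_def inner_axis)
  then have "emeasure (distr (\<Pi>\<^sub>M _\<in>UNIV. lborel) borel (\<lambda>f. \<chi> r c. f (r, c))) (box l u)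
      = emeasure (\<Pi>\<^sub>M _\<in>UNIV. lborel) (\<Pi>\<^sub>E p\<in>UNIV. box (l $ fst p $ snd p) (u $ fst p $ snd p))"
    by (subst emeasure_distr) (auto simp: space_PiM)
  also have "\<dots> = (\<Prod>p\<in>UNIV. emeasure lborel (box (l $ fst p $ snd p) (u $ fst p $ snd p)))"
    by (subst emeasure_PiM) auto
  also have "\<dots> = ennreal (\<Prod>p\<in>UNIV. \<Prod>b\<in>Basis. (u $ fst p $ snd p - l $ fst p $ snd p) \<bullet> b)"
    using le' by (auto simp: prod_ennreal prod_nonneg inner_diff_left)
  also have "(\<Prod>p\<in>UNIV. \<Prod>b\<in>Basis. (u $ fst p $ snd p - l $ fst p $ snd p) \<bullet> b)
      = (\<Prod>r\<in>UNIV. \<Prod>c\<in>UNIV. \<Prod>b\<in>Basis. (u $ r $ c - l $ r $ c) \<bullet> b)"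
    by (subst prod.cartesian_product) (simp add: split_beta')
  also have "\<dots> = (\<Prod>b\<in>Basis. (u - l) \<bullet> b)"
    by (simp add: prod_Basis_vec inner_axis)
  finally show "emeasure (distr (\<Pi>\<^sub>M _\<in>UNIV. lborel) borel (\<lambda>f. \<chi> r c. f (r, c))) (box l u)
      = ennreal (\<Prod>b\<in>Basis. (u - l) \<bullet> b)" .
qed simp

lemma norm_matrix_power2: "(norm x)\<^sup>2 = (\<Sum>p\<in>UNIV. (norm (x $ fst p $ snd p))\<^sup>2)"
  for x :: "'a::real_normed_vector ^ 'c::finite ^ 'r::finite"
proof -
  have "(norm x)\<^sup>2 = (\<Sum>r\<in>UNIV. \<Sum>c\<in>UNIV. (norm (x $ r $ c))\<^sup>2)"
    by (simp add: norm_vec_def L2_set_def sum_nonneg)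
  then show ?thesis
    by (simp add: sum.cartesian_product split_beta')
qed

text \<open>With one common variance the product of the entry densities depends on the Frobenius
  norm alone, which suits completing the square. \<open>C\<close> may stay existential because
  independence can be read off an unnormalised factorisation.\<close>

lemma (in prob_space) distr_indep_CN_entries:
  fixes X :: "'a \<Rightarrow> complex ^ 'c::finite ^ 'r::finite"
  assumes X: "indep_CN_entries M X (\<lambda>_. v)" and [measurable]: "X \<in> borel_measurable M"
    and v: "v > 0"
  shows "\<exists>C\<ge>0. distr M borel X = density lborel (\<lambda>x. ennreal (C * exp (- (norm x)\<^sup>2 / v)))"
proof -
  let ?m = "\<lambda>f. \<chi> r c. f (r, c) :: complex ^ 'c ^ 'r"
  define Y where "Y = (\<lambda>p \<omega>. X \<omega> $ fst p $ snd p)"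
  define f where "f = (\<lambda>z. ennreal (exp (- (cmod z)\<^sup>2 / v) / (pi * v)))"
  define n where "n = card (UNIV :: ('r \<times> 'c) set)"
  define C where "C = (1 / (pi * v)) ^ n"
  have [measurable]: "f \<in> borel_measurable borel" "Y p \<in> borel_measurable M" for p
    unfolding f_def Y_def by measurable
  have CN: "distr M borel (Y p) = CN v" for p
    using X by (simp add: indep_CN_entries_def Y_def)
  have "indep_vars (\<lambda>_. borel) Y UNIV"
    using X by (simp add: indep_CN_entries_def Y_def split_beta')
  then have "distr M (\<Pi>\<^sub>M _\<in>UNIV. borel) (\<lambda>\<omega>. \<lambda>p\<in>UNIV. Y p \<omega>) = (\<Pi>\<^sub>M p\<in>UNIV. distr M borel (Y p))"
    by (subst (asm) indep_vars_iff_distr_eq_PiM) auto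
  also have "\<dots> = (\<Pi>\<^sub>M p\<in>(UNIV :: ('r \<times> 'c) set). density lborel f)"
    using CN_eq_density[OF v] by (simp add: CN f_def)
  also have "\<dots> = density (\<Pi>\<^sub>M p\<in>UNIV. lborel) (\<lambda>x. \<Prod>p\<in>UNIV. f (x p))"
  proof (rule product_sigma_finite.PiM_density)
    show "product_sigma_finite (\<lambda>_::'r \<times> 'c. lborel :: complex measure)" ..
    have "prob_space (CN v)"
      using CN[of undefined] by (metis prob_space_distr \<open>Y undefined \<in> borel_measurable M\<close>)
    then show "sigma_finite_measure (density lborel f)"
      unfolding f_def CN_eq_density[OF v, symmetric] by (rule prob_space_imp_sigma_finite)
  qed auto
  also have "(\<lambda>x. \<Prod>p\<in>UNIV. f (x p)) = (\<lambda>x. ennreal (C * exp (- (norm (?m x))\<^sup>2 / v)))"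
  proof
    fix x :: "'r \<times> 'c \<Rightarrow> complex"
    have "(\<Prod>p\<in>UNIV. f (x p)) = ennreal (\<Prod>p\<in>UNIV. exp (- (cmod (x p))\<^sup>2 / v) / (pi * v))"
      unfolding f_def using v by (subst prod_ennreal) auto
    also have "(\<Prod>p\<in>UNIV. exp (- (cmod (x p))\<^sup>2 / v) / (pi * v)) = C * exp (\<Sum>p\<in>UNIV. - (cmod (x p))\<^sup>2 / v)"
      by (simp add: prod_dividef C_def n_def exp_sum power_one_over field_simps)
    also have "(\<Sum>p\<in>UNIV. - (cmod (x p))\<^sup>2 / v) = - (norm (?m x))\<^sup>2 / v"
      by (simp add: norm_matrix_power2 sum_negf sum_divide_distrib)
    finally show "(\<Prod>p\<in>UNIV. f (x p)) = ennreal (C * exp (- (norm (?m x))\<^sup>2 / v))" .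
  qed
  finally have *: "distr M (\<Pi>\<^sub>M _\<in>UNIV. borel) (\<lambda>\<omega>. \<lambda>p\<in>UNIV. Y p \<omega>) =
    density (\<Pi>\<^sub>M p\<in>UNIV. lborel) (\<lambda>x. ennreal (C * exp (- (norm (?m x))\<^sup>2 / v)))" .
  have m1 [measurable]: "?m \<in> borel_measurable (\<Pi>\<^sub>M _\<in>UNIV. borel)"
    by measurable
  have m2 [measurable]: "?m \<in> borel_measurable (\<Pi>\<^sub>M _\<in>UNIV. lborel)"
    by measurable
  have "distr M borel X = distr (distr M (\<Pi>\<^sub>M _\<in>UNIV. borel) (\<lambda>\<omega>. \<lambda>p\<in>UNIV. Y p \<omega>)) borel ?m"
    by (subst distr_distr) (auto simp: comp_def Y_def)
  also have "\<dots> = density (distr (\<Pi>\<^sub>M _\<in>UNIV. lborel) borel ?m) (\<lambda>x. ennreal (C * exp (- (norm x)\<^sup>2 / v)))"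
    unfolding * by (subst density_distr) auto
  also have "\<dots> = density lborel (\<lambda>x. ennreal (C * exp (- (norm x)\<^sup>2 / v)))"
    by (simp add: distr_PiM_lborel_matrix)
  finally show ?thesis
    using v by (intro exI[of _ C]) (auto simp: C_def)
qed

section \<open>Independence of variables of different types\<close>

text \<open>
  \<^const>\<open>prob_space.indep_var\<close> forces both variables to have the same type, so independence is
  expressed through the generated \<open>\<sigma>\<close>-algebras.
\<close>

definition vimage_events :: "'a measure \<Rightarrow> ('a \<Rightarrow> 'b) \<Rightarrow> 'b measure \<Rightarrow> 'a set set" where
  "vimage_events M X S = {X -` A \<inter> space M | A. A \<in> sets S}"

lemma vimage_eventsI: "A \<in> sets S \<Longrightarrow> X -` A \<inter> space M \<in> vimage_events M X S"
  by (auto simp: vimage_events_def)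

lemma events_of_eq_vimage_events: "events_of M X = vimage_events M X borel"
  by (simp add: events_of_def vimage_events_def)

lemma Int_stable_vimage_events: "Int_stable (vimage_events M X S)"
proof (rule Int_stableI)
  fix a b assume "a \<in> vimage_events M X S" "b \<in> vimage_events M X S"
  then obtain A B where "a = X -` A \<inter> space M" "b = X -` B \<inter> space M" "A \<in> sets S" "B \<in> sets S"
    unfolding vimage_events_def by blast
  moreover from this have "a \<inter> b = X -` (A \<inter> B) \<inter> space M"
    by auto
  ultimately show "a \<inter> b \<in> vimage_events M X S"
    using vimage_eventsI[OF sets.Int] by metis
qed

lemma vimage_events_subset_sets: "X \<in> measurable M S \<Longrightarrow> vimage_events M X S \<subseteq> sets M"
  by (auto simp: vimage_events_def)

lemma vimage_events_subset_sigma_sets: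
  assumes X: "X \<in> measurable (sigma (space M) A) S" and A: "A \<subseteq> Pow (space M)"
  shows "vimage_events M X S \<subseteq> sigma_sets (space M) A"
  using measurable_sets[OF X] A
  by (auto simp: vimage_events_def space_measure_of_conv sets_measure_of)

lemma vimage_events_comp_subset:
  assumes X: "X \<in> measurable M S" and f: "f \<in> measurable S T"
  shows "vimage_events M (\<lambda>\<omega>. f (X \<omega>)) T \<subseteq> vimage_events M X S"
proof
  fix B assume "B \<in> vimage_events M (\<lambda>\<omega>. f (X \<omega>)) T"
  then obtain A where A: "A \<in> sets T" "B = (\<lambda>\<omega>. f (X \<omega>)) -` A \<inter> space M"
    by (auto simp: vimage_events_def)
  then have "B = X -` (f -` A \<inter> space S) \<inter> space M"
    using measurable_space[OF X] by auto
  then show "B \<in> vimage_events M X S"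
    using vimage_eventsI[OF measurable_sets[OF f A(1)]] by metis
qed

lemma measurable_sigma_vimage_events:
  assumes X: "X \<in> measurable M S" and A: "vimage_events M X S \<subseteq> A" "A \<subseteq> Pow (space M)"
  shows "X \<in> measurable (sigma (space M) A) S"
proof (rule measurableI)
  fix B assume "B \<in> sets S"
  then have "X -` B \<inter> space M \<in> A"
    using A(1) by (blast intro: vimage_eventsI)
  then show "X -` B \<inter> space (sigma (space M) A) \<in> sets (sigma (space M) A)"
    using A(2) by (auto simp: space_measure_of_conv sets_measure_of)
qed (use measurable_space[OF X] in \<open>auto simp: space_measure_of_conv\<close>)

lemma (in prob_space) indep_set_mono: "indep_set A B \<Longrightarrow> A' \<subseteq> A \<Longrightarrow> B' \<subseteq> B \<Longrightarrow> indep_set A' B'"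
  unfolding indep_sets2_eq by blast

lemma (in prob_space) indep_set_vimage_comp:
  assumes "indep_set (vimage_events M X S) (vimage_events M Y T)"
    and "X \<in> measurable M S" "Y \<in> measurable M T" "f \<in> measurable S S'" "g \<in> measurable T T'"
  shows "indep_set (vimage_events M (\<lambda>\<omega>. f (X \<omega>)) S') (vimage_events M (\<lambda>\<omega>. g (Y \<omega>)) T')"
  by (rule indep_set_mono[OF assms(1) vimage_events_comp_subset[OF assms(2,4)]
        vimage_events_comp_subset[OF assms(3,5)]])

text \<open>The preimages form an intersection-stable family, so passing to the generated
  sigma-algebras does not change independence.\<close>

lemma (in prob_space) indep_var_iff_vimage_events:
  "indep_var S X T Y \<longleftrightarrow> random_variable S X \<and> random_variable T Y \<and>
     indep_set (vimage_events M X S) (vimage_events M Y T)"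
  unfolding indep_var_eq vimage_events_def[symmetric]
  using indep_set_sigma_sets[OF _ Int_stable_vimage_events[of M X S] Int_stable_vimage_events[of M Y T]]
    indep_set_mono[OF _ sigma_sets_superset_generator[of "vimage_events M X S" "space M"]
      sigma_sets_superset_generator[of "vimage_events M Y T" "space M"]]
  by metis

lemma (in prob_space) indep_set_vimage_eventsD:
  assumes "indep_set (vimage_events M X S) (vimage_events M Y T)" "A \<in> sets S" "B \<in> sets T"
  shows "prob (X -` A \<inter> Y -` B \<inter> space M) = prob (X -` A \<inter> space M) * prob (Y -` B \<inter> space M)"
proof -
  have "X -` A \<inter> Y -` B \<inter> space M = (X -` A \<inter> space M) \<inter> (Y -` B \<inter> space M)"
    by auto
  then show ?thesis
    using indep_setD[OF assms(1) vimage_eventsI[OF assms(2)] vimage_eventsI[OF assms(3)]] by simp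
qed

lemma (in prob_space) indep_set_vimage_eventsI:
  assumes X[measurable]: "random_variable S X" and Y[measurable]: "random_variable T Y"
    and eq: "\<And>A B. A \<in> sets S \<Longrightarrow> B \<in> sets T \<Longrightarrow>
      prob (X -` A \<inter> Y -` B \<inter> space M) = prob (X -` A \<inter> space M) * prob (Y -` B \<inter> space M)"
  shows "indep_set (vimage_events M X S) (vimage_events M Y T)"
  unfolding indep_sets2_eq
proof (intro conjI ballI)
  fix a b assume "a \<in> vimage_events M X S" "b \<in> vimage_events M Y T"
  then obtain A B where "a = X -` A \<inter> space M" "b = Y -` B \<inter> space M" "A \<in> sets S" "B \<in> sets T"
    by (auto simp: vimage_events_def)
  moreover from this have "a \<inter> b = X -` A \<inter> Y -` B \<inter> space M"
    by auto
  ultimately show "prob (a \<inter> b) = prob a * prob b"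
    using eq by simp
qed (auto intro: vimage_events_subset_sets[THEN subsetD, rotated] X Y)

lemma (in prob_space) distr_pair_eq_pair_measure:
  assumes [measurable]: "random_variable S X" "random_variable T Y"
    and ind: "indep_set (vimage_events M X S) (vimage_events M Y T)"
  shows "distr M (S \<Otimes>\<^sub>M T) (\<lambda>\<omega>. (X \<omega>, Y \<omega>)) = distr M S X \<Otimes>\<^sub>M distr M T Y"
proof (rule sym, rule pair_measure_eqI)
  show "sigma_finite_measure (distr M S X)" "sigma_finite_measure (distr M T Y)"
    by (auto intro!: prob_space_imp_sigma_finite prob_space_distr)
  show "sets (distr M S X \<Otimes>\<^sub>M distr M T Y) = sets (distr M (S \<Otimes>\<^sub>M T) (\<lambda>\<omega>. (X \<omega>, Y \<omega>)))"
    by (simp cong: sets_pair_measure_cong)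
  fix A B assume "A \<in> sets (distr M S X)" "B \<in> sets (distr M T Y)"
  then have AB[measurable]: "A \<in> sets S" "B \<in> sets T"
    by auto
  have "(\<lambda>\<omega>. (X \<omega>, Y \<omega>)) -` (A \<times> B) \<inter> space M = X -` A \<inter> Y -` B \<inter> space M"
    by auto
  then show "emeasure (distr M S X) A * emeasure (distr M T Y) B
      = emeasure (distr M (S \<Otimes>\<^sub>M T) (\<lambda>\<omega>. (X \<omega>, Y \<omega>))) (A \<times> B)"
    using indep_set_vimage_eventsD[OF ind AB]
    by (simp add: emeasure_distr emeasure_eq_measure ennreal_mult)
qed

text \<open>On rectangles, \<open>P(X,Y,Z) = P(X) P(Y,Z) = P(X) P(Y) P(Z) = P(X,Y) P(Z)\<close>;
  rectangles are intersection-stable and generate the events of \<open>(X, Y)\<close>. It will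
  regroup downlink estimate, self-interference estimate and residual.\<close>

lemma (in prob_space) indep_set_pair_assoc:
  assumes [measurable]: "random_variable S X" "random_variable T Y" "random_variable U Z"
    and XYZ: "indep_set (vimage_events M X S) (vimage_events M (\<lambda>\<omega>. (Y \<omega>, Z \<omega>)) (T \<Otimes>\<^sub>M U))"
    and YZ: "indep_set (vimage_events M Y T) (vimage_events M Z U)"
  shows "indep_set (vimage_events M (\<lambda>\<omega>. (X \<omega>, Y \<omega>)) (S \<Otimes>\<^sub>M T)) (vimage_events M Z U)"
proof -
  define A where "A = {X -` a \<inter> Y -` b \<inter> space M | a b. a \<in> sets S \<and> b \<in> sets T}"
  have A: "X -` a \<inter> Y -` b \<inter> space M \<in> A" if "a \<in> sets S" "b \<in> sets T" for a b
    using that by (auto simp: A_def)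
  have Pow: "A \<subseteq> Pow (space M)"
    by (auto simp: A_def)
  have 3: "prob (X -` a \<inter> Y -` b \<inter> Z -` c \<inter> space M)
      = prob (X -` a \<inter> Y -` b \<inter> space M) * prob (Z -` c \<inter> space M)"
    if [measurable]: "a \<in> sets S" "b \<in> sets T" "c \<in> sets U" for a b c
  proof -
    have *: "(\<lambda>\<omega>. (Y \<omega>, Z \<omega>)) -` (b \<times> c) = Y -` b \<inter> Z -` c" for b c
      by auto
    \<comment> \<open>Taking the whole space for \<open>Z\<close> in \<open>XYZ\<close> yields the
      remaining factorisation of \<open>P(X,Y)\<close>.\<close>
    have "Z -` space U \<inter> space M = space M"
      using measurable_space[OF assms(3)] by auto
    then have "X -` a \<inter> (Y -` b \<inter> Z -` space U) \<inter> space M = X -` a \<inter> Y -` b \<inter> space M"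
      "Y -` b \<inter> Z -` space U \<inter> space M = Y -` b \<inter> space M"
      by auto
    then show ?thesis
      using indep_set_vimage_eventsD[OF XYZ that(1) pair_measureI[OF that(2) that(3)]]
        indep_set_vimage_eventsD[OF XYZ that(1) pair_measureI[OF that(2) sets.top]]
        indep_set_vimage_eventsD[OF YZ that(2) that(3)]
      by (simp add: * Int_assoc)
  qed
  have "indep_set (sigma_sets (space M) A) (sigma_sets (space M) (vimage_events M Z U))"
  proof (rule indep_set_sigma_sets)
    show "Int_stable A"
    proof (rule Int_stableI)
      fix p q assume "p \<in> A" "q \<in> A"
      then obtain a b a' b' where "p = X -` a \<inter> Y -` b \<inter> space M" "q = X -` a' \<inter> Y -` b' \<inter> space M"
        "a \<in> sets S" "b \<in> sets T" "a' \<in> sets S" "b' \<in> sets T"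
        unfolding A_def by blast
      moreover from this have "p \<inter> q = X -` (a \<inter> a') \<inter> Y -` (b \<inter> b') \<inter> space M"
        by auto
      ultimately show "p \<inter> q \<in> A"
        using A[OF sets.Int sets.Int] by metis
    qed
    show "indep_set A (vimage_events M Z U)"
      unfolding indep_sets2_eq
    proof (intro conjI ballI)
      show "A \<subseteq> events" "vimage_events M Z U \<subseteq> events"
        by (auto simp: A_def vimage_events_subset_sets)
      fix p q assume "p \<in> A" "q \<in> vimage_events M Z U"
      then obtain a b c where *: "p = X -` a \<inter> Y -` b \<inter> space M" "q = Z -` c \<inter> space M"
        "a \<in> sets S" "b \<in> sets T" "c \<in> sets U"
        unfolding A_def vimage_events_def by blast
      then have "p \<inter> q = X -` a \<inter> Y -` b \<inter> Z -` c \<inter> space M"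
        by auto
      then show "prob (p \<inter> q) = prob p * prob q"
        using * 3 by simp
    qed
  qed (rule Int_stable_vimage_events)
  moreover have "vimage_events M (\<lambda>\<omega>. (X \<omega>, Y \<omega>)) (S \<Otimes>\<^sub>M T) \<subseteq> sigma_sets (space M) A"
  proof (intro vimage_events_subset_sigma_sets measurable_Pair measurable_sigma_vimage_events Pow)
    have X: "X -` a \<inter> Y -` space T \<inter> space M = X -` a \<inter> space M" for a
      using measurable_space[OF assms(2)] by auto
    show "vimage_events M X S \<subseteq> A"
      using A[OF _ sets.top[of T], unfolded X] by (auto simp: vimage_events_def)
    have Y: "X -` space S \<inter> Y -` b \<inter> space M = Y -` b \<inter> space M" for b
      using measurable_space[OF assms(1)] by auto
    show "vimage_events M Y T \<subseteq> A"
      using A[OF sets.top[of S], unfolded Y] by (auto simp: vimage_events_def)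
  qed fact+
  ultimately show ?thesis
    by (rule indep_set_mono[OF _ _ sigma_sets_superset_generator])
qed

text \<open>Disjoint blocks of an independent family generate independent sigma-algebras.
  Measurability with respect to the generated sigma-algebra says that \<open>X\<close> depends on
  block \<open>I\<close> only, and \<open>Y\<close> on block \<open>J\<close> only.\<close>

lemma (in prob_space) indep_set_vimage_groups:
  assumes "indep_sets E K" "I \<inter> J = {}" "I \<union> J \<subseteq> K" "\<And>i. i \<in> K \<Longrightarrow> Int_stable (E i)"
    and "X \<in> measurable (sigma (space M) (\<Union>i\<in>I. E i)) S"
    and "Y \<in> measurable (sigma (space M) (\<Union>j\<in>J. E j)) T"
  shows "indep_set (vimage_events M X S) (vimage_events M Y T)"
proof (rule indep_set_mono)
  have "indep_sets E (\<Union>b\<in>UNIV. case_bool I J b)"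
    by (rule indep_sets_mono_index[OF _ assms(1)]) (use assms(3) in \<open>auto simp: UNIV_bool\<close>)
  then have "indep_sets (\<lambda>b. sigma_sets (space M) (\<Union>i\<in>case_bool I J b. E i)) UNIV"
  proof (rule indep_sets_collect_sigma)
    show "Int_stable (E i)" if "i \<in> case_bool I J b" for i b
      using that assms(3,4) by (cases b) auto
    show "disjoint_family_on (case_bool I J) UNIV"
      using assms(2) by (auto simp: disjoint_family_on_def split: bool.splits)
  qed
  then show "indep_set (sigma_sets (space M) (\<Union>i\<in>I. E i)) (sigma_sets (space M) (\<Union>j\<in>J. E j))"
    unfolding indep_set_def
    by (rule indep_sets_mono_sets) (auto split: bool.splits)
  have "E i \<subseteq> Pow (space M)" if "i \<in> K" for i
    using assms(1) that sets.space_closed[of M] by (auto simp: indep_sets_def)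
  then have "(\<Union>i\<in>I. E i) \<subseteq> Pow (space M)" "(\<Union>i\<in>J. E i) \<subseteq> Pow (space M)"
    using assms(3) by blast+
  then show "vimage_events M X S \<subseteq> sigma_sets (space M) (\<Union>i\<in>I. E i)"
    "vimage_events M Y T \<subseteq> sigma_sets (space M) (\<Union>j\<in>J. E j)"
    using assms(5,6) by (simp_all only: vimage_events_subset_sigma_sets)
qed

text \<open>The mass of a rectangle is \<open>F A * G B\<close>, and total mass 1 gives
  \<open>F UNIV * G UNIV = 1\<close>. Multiplying by this 1 turns the factorisation into one by
  marginal probabilities, without normalising \<open>f\<close> and \<open>g\<close>
  separately.\<close>

lemma (in prob_space) indep_set_product_density:
  assumes [measurable]: "X \<in> borel_measurable M" "Y \<in> borel_measurable M"
    and "sigma_finite_measure N2"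
    and [measurable]: "f \<in> borel_measurable N1" "g \<in> borel_measurable N2"
    and [measurable_cong]: "sets N1 = sets borel" "sets N2 = sets borel"
    and law: "distr M (borel \<Otimes>\<^sub>M borel) (\<lambda>\<omega>. (X \<omega>, Y \<omega>)) = density (N1 \<Otimes>\<^sub>M N2) (\<lambda>(x, y). f x * g y)"
  shows "indep_set (vimage_events M X borel) (vimage_events M Y borel)"
proof -
  interpret N2: sigma_finite_measure N2 by fact
  define F where "F A = (\<integral>\<^sup>+x. f x * indicator A x \<partial>N1)" for A
  define G where "G A = (\<integral>\<^sup>+x. g x * indicator A x \<partial>N2)" for A
  have FG: "ennreal (prob (X -` A \<inter> Y -` B \<inter> space M)) = F A * G B" if [measurable]: "A \<in> sets borel" "B \<in> sets borel" for A B
  proof -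
    have "ennreal (prob (X -` A \<inter> Y -` B \<inter> space M)) = emeasure (distr M (borel \<Otimes>\<^sub>M borel) (\<lambda>\<omega>. (X \<omega>, Y \<omega>))) (A \<times> B)"
      by (subst emeasure_distr) (auto simp: emeasure_eq_measure intro!: arg_cong[where f=prob])
    also have "\<dots> = (\<integral>\<^sup>+p. (case p of (x, y) \<Rightarrow> f x * g y) * indicator (A \<times> B) p \<partial>(N1 \<Otimes>\<^sub>M N2))"
      unfolding law by (subst emeasure_density) auto
    also have "\<dots> = (\<integral>\<^sup>+x. \<integral>\<^sup>+y. (f x * indicator A x) * (g y * indicator B y) \<partial>N2 \<partial>N1)"
      by (subst N2.nn_integral_fst[symmetric]) (auto simp: indicator_times mult_ac)
    also have "\<dots> = F A * G B"
      unfolding F_def G_def by (simp add: nn_integral_cmult nn_integral_multc)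
    finally show ?thesis .
  qed
  have "prob (X -` A \<inter> Y -` B \<inter> space M) = prob (X -` A \<inter> space M) * prob (Y -` B \<inter> space M)"
    if [measurable]: "A \<in> sets borel" "B \<in> sets borel" for A B
  proof -
    have "ennreal (prob (X -` A \<inter> space M) * prob (Y -` B \<inter> space M)) = F A * G UNIV * (F UNIV * G B)"
      using FG[of A UNIV] FG[of UNIV B] by (simp add: ennreal_mult)
    also have "\<dots> = (F UNIV * G UNIV) * (F A * G B)"
      by (simp add: mult_ac)
    also have "F UNIV * G UNIV = 1"
      using FG[of UNIV UNIV] by (simp add: prob_space)
    also have "1 * (F A * G B) = ennreal (prob (X -` A \<inter> Y -` B \<inter> space M))"
      using FG[of A B] by simp
    finally show ?thesis
      by simp
  qed
  then show ?thesis
    by (intro indep_set_vimage_eventsI) auto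
qed

section \<open>Gaussian regression\<close>

text \<open>
  The map from \<open>(H, E)\<close> to the pair of \<open>H + E\<close> and the residual is a product of two shears, so no
  Jacobian is needed.
\<close>

lemma distr_lborel_shear_fst:
  fixes g :: "'b::euclidean_space \<Rightarrow> 'a::euclidean_space"
  assumes [measurable]: "g \<in> borel_measurable borel"
  shows "distr (lborel \<Otimes>\<^sub>M lborel) (borel \<Otimes>\<^sub>M borel) (\<lambda>(x, y). (x + g y, y)) = lborel \<Otimes>\<^sub>M lborel"
proof (rule measure_eqI)
  fix A assume "A \<in> sets (distr (lborel \<Otimes>\<^sub>M lborel) (borel \<Otimes>\<^sub>M borel) (\<lambda>(x, y). (x + g y, y)))"
  then have [measurable]: "A \<in> sets (borel \<Otimes>\<^sub>M borel)"
    by simp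
  have "emeasure (distr (lborel \<Otimes>\<^sub>M lborel) (borel \<Otimes>\<^sub>M borel) (\<lambda>(x, y). (x + g y, y))) A
      = (\<integral>\<^sup>+p. indicator A (case p of (x, y) \<Rightarrow> (x + g y, y)) \<partial>(lborel \<Otimes>\<^sub>M lborel))"
    by (subst nn_integral_indicator[symmetric], simp, subst nn_integral_distr) auto
  \<comment> \<open>For fixed \<open>y\<close> the map only translates \<open>x\<close>, so the
    inner integral is invariant whatever the measurable shift \<open>g\<close> is.\<close>
  also have "\<dots> = (\<integral>\<^sup>+y. \<integral>\<^sup>+x. indicator A (g y + x, y) \<partial>lborel \<partial>lborel)"
    by (subst lborel_pair.nn_integral_snd[symmetric]) (auto simp: add.commute)
  also have "\<dots> = (\<integral>\<^sup>+y. \<integral>\<^sup>+x. indicator A (x, y) \<partial>lborel \<partial>lborel)"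
  proof (rule nn_integral_cong)
    fix y
    show "(\<integral>\<^sup>+x. indicator A (g y + x, y) \<partial>lborel) = (\<integral>\<^sup>+x. indicator A (x, y) \<partial>lborel)"
      by (subst (2) lborel_distr_plus[of "g y", symmetric], subst nn_integral_distr) auto
  qed
  also have "\<dots> = emeasure (lborel \<Otimes>\<^sub>M lborel) A"
    by (subst lborel_pair.nn_integral_snd) auto
  finally show "emeasure (distr (lborel \<Otimes>\<^sub>M lborel) (borel \<Otimes>\<^sub>M borel) (\<lambda>(x, y). (x + g y, y))) A
      = emeasure (lborel \<Otimes>\<^sub>M lborel) A" .
qed (simp cong: sets_pair_measure_cong)

text \<open>Conjugating with the coordinate swap reduces this shear to the previous one.\<close>

lemma distr_lborel_shear_snd:
  fixes g :: "'a::euclidean_space \<Rightarrow> 'b::euclidean_space"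
  assumes [measurable]: "g \<in> borel_measurable borel"
  shows "distr (lborel \<Otimes>\<^sub>M lborel) (borel \<Otimes>\<^sub>M borel) (\<lambda>(x, y). (x, y + g x)) = lborel \<Otimes>\<^sub>M lborel"
proof -
  have "distr (lborel \<Otimes>\<^sub>M lborel) (borel \<Otimes>\<^sub>M borel) (\<lambda>(x, y). (x, y + g x))
     = distr (distr (distr (lborel \<Otimes>\<^sub>M lborel) (lborel \<Otimes>\<^sub>M lborel) (\<lambda>(x, y). (y, x)))
         (borel \<Otimes>\<^sub>M borel) (\<lambda>(x, y). (x + g y, y))) (borel \<Otimes>\<^sub>M borel) (\<lambda>(x, y). (y, x))"
    by (simp add: distr_distr comp_def split_beta')
  also have "distr (lborel \<Otimes>\<^sub>M lborel) (lborel \<Otimes>\<^sub>M lborel) (\<lambda>(x, y). (y, x)) = (lborel \<Otimes>\<^sub>M lborel :: ('b \<times> 'a) measure)"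
    by (rule lborel_pair.distr_pair_swap[symmetric])
  also have "distr (lborel \<Otimes>\<^sub>M lborel) (borel \<Otimes>\<^sub>M borel) (\<lambda>(x, y). (x + g y, y)) = (lborel \<Otimes>\<^sub>M lborel :: ('b \<times> 'a) measure)"
    by (rule distr_lborel_shear_fst) fact
  also have "distr (lborel \<Otimes>\<^sub>M lborel) (borel \<Otimes>\<^sub>M borel) (\<lambda>(x, y). (y, x)) = distr (lborel \<Otimes>\<^sub>M lborel) (lborel \<Otimes>\<^sub>M lborel) (\<lambda>(x :: 'b, y :: 'a). (y, x))"
    by (rule distr_cong) (auto cong: sets_pair_measure_cong)
  also have "\<dots> = (lborel \<Otimes>\<^sub>M lborel)"
    by (rule lborel_pair.distr_pair_swap[symmetric])
  finally show ?thesis .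
qed

text \<open>With \<open>y = h + e\<close> and \<open>w = e - c y\<close>, the exponent splits as
  \<open>|h|^2 + |e|^2 / v = |y|^2 / (1 + v) + |w|^2 (1 + v) / v\<close>, so the joint density of
  \<open>(y, w)\<close> is a product. The divisor 1 in the law of \<open>H\<close> is its entry
  variance.\<close>

lemma (in prob_space) indep_gaussian_regression:
  fixes H E :: "'a \<Rightarrow> 'b::euclidean_space"
  assumes [measurable]: "H \<in> borel_measurable M" "E \<in> borel_measurable M"
    and ind: "indep_set (vimage_events M H borel) (vimage_events M E borel)"
    and H: "distr M borel H = density lborel (\<lambda>x. ennreal (a * exp (- (norm x)\<^sup>2 / 1)))"
    and E: "distr M borel E = density lborel (\<lambda>x. ennreal (b * exp (- (norm x)\<^sup>2 / v)))"
    and pos: "a \<ge> 0" "b \<ge> 0" "v > 0"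
  shows "indep_set (vimage_events M (\<lambda>\<omega>. H \<omega> + E \<omega>) borel)
    (vimage_events M (\<lambda>\<omega>. E \<omega> - (v / (1 + v)) *\<^sub>R (H \<omega> + E \<omega>)) borel)"
proof -
  define c where "c = v / (1 + v)"
  define f where "f = (\<lambda>y::'b. ennreal (a * exp (- (norm y)\<^sup>2 / (1 + v))))"
  define g where "g = (\<lambda>w::'b. ennreal (b * exp (- (norm w)\<^sup>2 * (1 + v) / v)))"
  define T where "T = (\<lambda>(h::'b, e). (h + e, e - c *\<^sub>R (h + e)))"
  \<comment> \<open>\<open>k\<close> is the joint density in the new coordinates; the law of
    \<open>(H, E)\<close> will be recognised as having density \<open>k\<close> composed with
    \<open>T\<close>.\<close>
  define k where "k = (\<lambda>(y, w). f y * g w)"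
  have [measurable]: "f \<in> borel_measurable borel" "g \<in> borel_measurable borel"
    unfolding f_def g_def by measurable
  have k[measurable]: "k \<in> borel_measurable (borel \<Otimes>\<^sub>M borel)"
    unfolding k_def by measurable
  have T[measurable]: "T \<in> measurable (borel \<Otimes>\<^sub>M borel) (borel \<Otimes>\<^sub>M borel)"
    unfolding T_def by measurable
  have T'[measurable]: "T \<in> measurable (lborel \<Otimes>\<^sub>M lborel) (borel \<Otimes>\<^sub>M borel)"
    unfolding T_def by measurable
  have sf: "sigma_finite_measure (distr M borel E)"
    by (intro prob_space_imp_sigma_finite prob_space_distr) simp
  have "distr M (borel \<Otimes>\<^sub>M borel) (\<lambda>\<omega>. (H \<omega>, E \<omega>)) = distr M borel H \<Otimes>\<^sub>M distr M borel E"
    by (rule distr_pair_eq_pair_measure) (use ind in auto)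
  also have "\<dots> = density (lborel \<Otimes>\<^sub>M lborel)
      (\<lambda>(x, y). ennreal (a * exp (- (norm x)\<^sup>2 / 1)) * ennreal (b * exp (- (norm y)\<^sup>2 / v)))"
    using sf unfolding H E by (intro pair_measure_density) (auto intro: lborel.sigma_finite_measure_axioms)
  also have "(\<lambda>(x::'b, y::'b). ennreal (a * exp (- (norm x)\<^sup>2 / 1)) * ennreal (b * exp (- (norm y)\<^sup>2 / v)))
      = (\<lambda>p. k (T p))"
  proof (rule ext, clarify)
    fix x y :: 'b
    have "(norm (y - c *\<^sub>R (x + y)))\<^sup>2 = (norm (((1 - c) *\<^sub>R y - c *\<^sub>R x)))\<^sup>2"
      by (simp add: algebra_simps)
    also have "\<dots> = (norm y)\<^sup>2 * (1 - c)\<^sup>2 + c\<^sup>2 * (norm x)\<^sup>2 - 2 * c * (1 - c) * (x \<bullet> y)"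
      unfolding power2_norm_eq_inner
      by (simp add: inner_diff_left inner_diff_right inner_commute algebra_simps power2_eq_square)
    also have "1 - c = 1 / (1 + v)"
      using pos by (simp add: c_def field_simps)
    finally have 1: "(norm (y - c *\<^sub>R (x + y)))\<^sup>2
        = (norm y)\<^sup>2 * (1 / (1 + v))\<^sup>2 + c\<^sup>2 * (norm x)\<^sup>2 - 2 * c * (1 / (1 + v)) * (x \<bullet> y)" .
    have 2: "(norm (x + y))\<^sup>2 = (norm x)\<^sup>2 + (norm y)\<^sup>2 + 2 * (x \<bullet> y)"
      unfolding power2_norm_eq_inner
      by (simp add: inner_add_left inner_add_right inner_commute)
    have "(norm (x + y))\<^sup>2 / (1 + v) + (norm (y - c *\<^sub>R (x + y)))\<^sup>2 * (1 + v) / v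
        = (norm x)\<^sup>2 + (norm y)\<^sup>2 / v"
    proof -
      \<comment> \<open>\<open>X\<close>, \<open>Y\<close>, \<open>I\<close> stand for the two
        squared norms and the inner product. The choice of \<open>c\<close> shows in the
        cancellation of the \<open>I\<close> terms.\<close>
      have *: "(X + Y + 2 * I) / (1 + v)
          + (Y * (1 / (1 + v))\<^sup>2 + (v / (1 + v))\<^sup>2 * X - 2 * (v / (1 + v)) * (1 / (1 + v)) * I) * (1 + v) / v
          = X + Y / v" for X Y I :: real
      proof -
        have "1 + v \<noteq> 0" "v \<noteq> 0"
          using pos by auto
        then show ?thesis
          by (simp add: divide_simps power2_eq_square) algebra
      qed
      show ?thesis
        unfolding 1 2 unfolding c_def by (rule *)
    qed
    then have "exp (- (norm (x + y))\<^sup>2 / (1 + v)) * exp (- (norm (y - c *\<^sub>R (x + y)))\<^sup>2 * (1 + v) / v)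
        = exp (- (norm x)\<^sup>2 / 1) * exp (- (norm y)\<^sup>2 / v)"
      unfolding exp_add[symmetric] by simp
    then have "a * exp (- (norm (x + y))\<^sup>2 / (1 + v)) * (b * exp (- (norm (y - c *\<^sub>R (x + y)))\<^sup>2 * (1 + v) / v))
        = a * exp (- (norm x)\<^sup>2 / 1) * (b * exp (- (norm y)\<^sup>2 / v))"
      by (metis (no_types) mult.assoc mult.left_commute)
    then show "ennreal (a * exp (- (norm x)\<^sup>2 / 1)) * ennreal (b * exp (- (norm y)\<^sup>2 / v)) = k (T (x, y))"
      unfolding k_def T_def f_def g_def using pos by (auto simp: ennreal_mult[symmetric])
  qed
  finally have law: "distr M (borel \<Otimes>\<^sub>M borel) (\<lambda>\<omega>. (H \<omega>, E \<omega>)) = density (lborel \<Otimes>\<^sub>M lborel) (\<lambda>p. k (T p))" .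
  have "distr (lborel \<Otimes>\<^sub>M lborel) (borel \<Otimes>\<^sub>M borel) T
      = distr (distr (lborel \<Otimes>\<^sub>M lborel) (borel \<Otimes>\<^sub>M borel) (\<lambda>(x, y). (x + y, y)))
          (borel \<Otimes>\<^sub>M borel) (\<lambda>(x, y). (x, y + (- c) *\<^sub>R x))"
    by (subst distr_distr) (auto simp: comp_def T_def split_beta')
  also have "\<dots> = distr (lborel \<Otimes>\<^sub>M lborel) (borel \<Otimes>\<^sub>M borel) (\<lambda>(x, y). (x, y + (- c) *\<^sub>R x))"
    by (subst distr_lborel_shear_fst) auto
  also have "\<dots> = lborel \<Otimes>\<^sub>M lborel"
    by (rule distr_lborel_shear_snd) auto
  finally have lT: "distr (lborel \<Otimes>\<^sub>M lborel) (borel \<Otimes>\<^sub>M borel) T = lborel \<Otimes>\<^sub>M lborel" .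
  have "distr M (borel \<Otimes>\<^sub>M borel) (\<lambda>\<omega>. (H \<omega> + E \<omega>, E \<omega> - c *\<^sub>R (H \<omega> + E \<omega>)))
      = distr (distr M (borel \<Otimes>\<^sub>M borel) (\<lambda>\<omega>. (H \<omega>, E \<omega>))) (borel \<Otimes>\<^sub>M borel) T"
    by (subst distr_distr) (auto simp: comp_def T_def)
  also have "\<dots> = density (distr (lborel \<Otimes>\<^sub>M lborel) (borel \<Otimes>\<^sub>M borel) T) k"
    unfolding law by (rule density_distr[symmetric]) (rule k, rule T')
  also have "\<dots> = density (lborel \<Otimes>\<^sub>M lborel) (\<lambda>(y, w). f y * g w)"
    unfolding lT k_def ..
  finally show ?thesis
    unfolding c_def[symmetric]
    by (intro indep_set_product_density[where ?N1.0 = lborel and ?N2.0 = lborel])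
       (auto intro: lborel.sigma_finite_measure_axioms)
qed

section \<open>The precoder\<close>

text \<open>Up to signs these \<open>t\<close> are the eigenvalues of \<open>A\<close>. The reversed
  characteristic polynomial \<open>det (1 + s A)\<close> is used since its value 1 at
  \<open>s = 0\<close> shows at once that it is not the zero polynomial.\<close>

lemma finite_singular_shifts:
  fixes A :: "complex ^ 'n::finite ^ 'n"
  shows "finite {t. det (\<chi> i j. A $ i $ j + (if i = j then t else 0)) = 0}"
proof -
  define q where "q = det (\<chi> i j. [:if i = j then 1 else 0, A $ i $ j:] :: complex poly ^ 'n ^ 'n)"
  have q: "poly q s = det (\<chi> i j. (if i = j then 1 else 0) + s * A $ i $ j)" for s
    by (simp add: q_def det_def poly_sum poly_prod)
  have "poly q 0 = det (mat 1 :: complex ^ 'n ^ 'n)"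
    unfolding q by (simp add: mat_def)
  then have "q \<noteq> 0"
    by auto
  then have "finite {s. poly q s = 0}"
    by (rule poly_roots_finite)
  \<comment> \<open>A nonzero \<open>t\<close> corresponds to the root \<open>s = 1 / t\<close>,
    because each row of the shifted matrix is divided by \<open>t\<close>; \<open>t = 0\<close> has
    no such partner and is added by hand.\<close>
  moreover have "{t. det (\<chi> i j. A $ i $ j + (if i = j then t else 0)) = 0}
      \<subseteq> insert 0 (inverse ` {s. poly q s = 0})"
  proof safe
    fix t assume t: "det (\<chi> i j. A $ i $ j + (if i = j then t else 0)) = 0"
      and nin: "t \<notin> inverse ` {s. poly q s = 0}"
    show "t = 0"
    proof (rule ccontr)
      assume "t \<noteq> 0"
      have "poly q (inverse t) = det (\<chi> i. inverse t *s (\<chi> j. A $ i $ j + (if i = j then t else 0)))"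
        unfolding q using \<open>t \<noteq> 0\<close> by (intro arg_cong[where f=det]) (auto simp: vec_eq_iff field_simps)
      also have "\<dots> = 0"
        using t by (simp add: det_rows_mul)
      finally show False
        using nin by (auto intro!: image_eqI[of _ _ "inverse t"])
    qed
  qed
  ultimately show ?thesis
    by (meson finite.insertI finite_imageI finite_subset)
qed

text \<open>A nonsingular square block of columns makes the rows independent. If the Gram matrix
  kills \<open>x\<close>, then \<open>z = S^* x\<close> has squared norm \<open>x^* S z = 0\<close>,
  and the coordinates of \<open>z\<close> at the columns \<open>h j\<close> force
  \<open>x = 0\<close>.\<close>

lemma det_gram_nonzero:
  fixes S :: "complex ^ 'c::finite ^ 'r::finite" and h :: "'r \<Rightarrow> 'c"
  assumes "det (\<chi> i j. S $ i $ h j) \<noteq> 0"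
  shows "det (S ** conj_transpose S) \<noteq> 0"
proof -
  let ?B = "\<chi> i j. S $ i $ h j"
  have ker: "x = 0" if x: "(S ** conj_transpose S) *v x = 0" for x
  proof -
    define z where "z = conj_transpose S *v x"
    have Sz: "S *v z = 0"
      using x by (simp add: z_def matrix_vector_mul_assoc)
    have z: "cnj (z $ c) = (\<Sum>r\<in>UNIV. S $ r $ c * cnj (x $ r))" for c
      by (simp add: z_def matrix_vector_mult_def conj_transpose_def)
    have "(\<Sum>c\<in>UNIV. cnj (z $ c) * z $ c) = (\<Sum>c\<in>UNIV. \<Sum>r\<in>UNIV. cnj (x $ r) * (S $ r $ c * z $ c))"
      unfolding z by (simp add: sum_distrib_right sum_distrib_left mult_ac)
    also have "\<dots> = (\<Sum>r\<in>UNIV. cnj (x $ r) * (S *v z) $ r)"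
      by (subst sum.swap) (simp add: matrix_vector_mult_def sum_distrib_left)
    also have "\<dots> = 0"
      by (simp add: Sz)
    finally have "complex_of_real (\<Sum>c\<in>UNIV. (cmod (z $ c))\<^sup>2) = 0"
      by (simp add: complex_norm_square mult.commute del: of_real_power)
    then have "(\<Sum>c\<in>UNIV. (cmod (z $ c))\<^sup>2) = 0"
      by (simp only: of_real_eq_0_iff)
    then have "z $ c = 0" for c
      by (simp add: sum_nonneg_eq_0_iff)
    then have "transpose ?B *v (\<chi> r. cnj (x $ r)) = 0"
      using z by (auto simp: vec_eq_iff matrix_vector_mult_def transpose_def)
    moreover have "invertible (transpose ?B)"
      using assms by (simp add: invertible_det_nz det_transpose)
    ultimately have "(\<chi> r. cnj (x $ r)) = 0"
      using matrix_left_invertible_ker[of "transpose ?B"] by (metis invertible_left_inverse)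
    then show "x = 0"
      by (simp add: vec_eq_iff)
  qed
  then have "\<exists>B. B ** (S ** conj_transpose S) = mat 1"
    unfolding matrix_left_invertible_ker by blast
  then show ?thesis
    by (simp add: invertible_left_inverse[symmetric] invertible_det_nz)
qed

lemma matrix_inv_right_det: "A ** matrix_inv A = mat 1" if "det A \<noteq> 0"
  for A :: "'a::field ^ 'n::finite ^ 'n"
proof -
  have "\<exists>B. A ** B = mat 1 \<and> B ** A = mat 1"
    using that by (simp add: invertible_det_nz[symmetric] invertible_def)
  then show ?thesis
    unfolding matrix_inv_def by (rule someI2_ex) blast
qed

text \<open>
  All singular matrices share one junk inverse, because their defining predicate is the same constant
  \<open>\<lambda>_. False\<close>. Without this the precoder need not be measurable and Bochner integrals of it could
  degenerate to \<open>0\<close>.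
\<close>

lemma matrix_inv_singular: "matrix_inv A = matrix_inv 0" if "det A = 0"
  for A :: "'a::field ^ 'n::finite ^ 'n"
proof -
  have "C ** B \<noteq> mat 1" if "det C = 0" for B C :: "'a ^ 'n ^ 'n"
    using that det_mul[of C B] by (metis det_I mult_zero_left zero_neq_one)
  then have "A ** B \<noteq> mat 1" "(0 :: 'a ^ 'n ^ 'n) ** B \<noteq> mat 1" for B
    using that det_0[where ?'a = 'a and ?'n = 'n] by (auto simp: mat_def zero_vec_def)
  then show ?thesis
    unfolding matrix_inv_def by presburger
qed

lemma measurable_det:
  assumes [measurable]: "\<And>i j. (\<lambda>x. A x $ i $ j) \<in> borel_measurable M"
  shows "(\<lambda>x. det (A x :: complex ^ 'n::finite ^ 'n)) \<in> borel_measurable M"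
  unfolding det_def by measurable

text \<open>Cramer's rule makes each entry a quotient of determinants on the nonsingular matrices,
  and on the singular ones the entry is constant.\<close>

lemma measurable_matrix_inv:
  assumes [measurable]: "\<And>i j. (\<lambda>x. A x $ i $ j) \<in> borel_measurable M"
  shows "(\<lambda>x. matrix_inv (A x :: complex ^ 'n::finite ^ 'n) $ k $ l) \<in> borel_measurable M"
proof -
  have "matrix_inv B $ k $ l = (if det B = 0 then matrix_inv 0 $ k $ l
      else det (\<chi> i j. if j = k then axis l 1 $ i else B $ i $ j) / det B)" for B :: "complex ^ 'n ^ 'n"
  proof (cases "det B = 0")
    case False
    have "B *v (matrix_inv B *v axis l 1) = axis l 1"
      using matrix_inv_right_det[OF False] by (simp add: matrix_vector_mul_assoc)
    then have "(matrix_inv B *v axis l 1) $ k = det (\<chi> i j. if j = k then axis l 1 $ i else B $ i $ j) / det B"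
      using cramer[OF False, of "matrix_inv B *v axis l 1" "axis l 1"] by simp
    then show ?thesis
      using False by (simp add: matrix_vector_mult_def[of "matrix_inv B"] axis_def[of l 1] if_distrib cong: if_cong)
  qed (simp add: matrix_inv_singular)
  moreover have [measurable]: "(\<lambda>x. det (\<chi> i j. if j = k then axis l 1 $ i else A x $ i $ j)) \<in> borel_measurable M"
    by (rule measurable_det) simp
  moreover have [measurable]: "(\<lambda>x. det (A x)) \<in> borel_measurable M"
    by (rule measurable_det) simp
  ultimately show ?thesis
    by simp
qed

lemma borel_measurable_cnj[measurable (raw)]:
  "f \<in> borel_measurable M \<Longrightarrow> (\<lambda>x. cnj (f x)) \<in> borel_measurable M"
  by (rule measurable_compose[OF _ borel_measurable_continuous_onI]) (auto intro: continuous_intros)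

lemma measurable_sps_precoder:
  fixes A :: "'a \<Rightarrow> complex ^ 'm::finite ^ 'd::finite" and B :: "'a \<Rightarrow> complex ^ 'm ^ 'n::finite"
  assumes [measurable]: "A \<in> borel_measurable M" "B \<in> borel_measurable M"
  shows "(\<lambda>x. sps_precoder (A x) (B x) $ k $ m) \<in> borel_measurable M"
proof -
  let ?S = "\<lambda>x. stack_rows (A x) (B x)"
  have S[measurable]: "(\<lambda>x. ?S x $ r $ c) \<in> borel_measurable M" for r c
    by (cases r) (simp_all add: stack_rows_def)
  have G: "(\<lambda>x. (?S x ** conj_transpose (?S x)) $ i $ j) \<in> borel_measurable M" for i j
    by (simp add: matrix_matrix_mult_def conj_transpose_def)
  have [measurable]: "(\<lambda>x. matrix_inv (?S x ** conj_transpose (?S x)) $ i $ j) \<in> borel_measurable M" for i j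
    by (rule measurable_matrix_inv[OF G])
  have R[measurable]: "(\<lambda>x. right_pseudo_inverse (?S x) $ i $ j) \<in> borel_measurable M" for i j
    unfolding right_pseudo_inverse_def
    by (simp add: matrix_matrix_mult_def[of "conj_transpose (stack_rows (A x) (B x))" for x]
        conj_transpose_def[of "stack_rows (A x) (B x)" for x, THEN arg_cong[where f="\<lambda>X. X $ p $ q" for p q]])
  have "(\<lambda>x. column (Inl m) (right_pseudo_inverse (?S x))) \<in> borel_measurable M"
    unfolding column_def by measurable
  then show ?thesis
    by (simp add: sps_precoder_def Let_def column_def)
qed

text \<open>A coordinate is at most the norm of its vector. The bound holds at every sample point:
  for \<open>f = 0\<close> division by zero gives 0, and on singular Gram matrices the default
  inverse is normalised in the same way.\<close>

lemma cmod_sps_precoder_le: "cmod (sps_precoder A B $ k $ m) \<le> 1"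
proof -
  define f where "f = column (Inl m) (right_pseudo_inverse (stack_rows A B))"
  have "cmod (f $ k) \<le> norm f"
    by (rule Finite_Cartesian_Product.norm_nth_le)
  also have "\<dots> \<le> sqrt (real CARD('a)) * norm f"
    by (simp add: mult_le_cancel_right1)
  finally have "cmod (f $ k) \<le> sqrt (real CARD('a)) * norm f" .
  moreover have "sps_precoder A B $ k $ m = f $ k / complex_of_real (sqrt (real CARD('a)) * norm f)"
    by (simp add: sps_precoder_def f_def Let_def)
  ultimately show ?thesis
    by (cases "f = 0") (simp_all add: norm_divide norm_mult divide_le_eq_1 del: of_real_mult)
qed

text \<open>This is an entry of \<open>S S^+ = 1\<close> in a self-interference row and a downlink
  column, hence off the diagonal; normalising the column keeps it 0.\<close>

lemma sps_precoder_orthogonal: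
  assumes "det (stack_rows A B ** conj_transpose (stack_rows A B)) \<noteq> 0"
  shows "(\<Sum>l\<in>UNIV. B $ i $ l * sps_precoder A B $ l $ m) = 0"
proof -
  let ?S = "stack_rows A B"
  let ?f = "column (Inl m) (right_pseudo_inverse ?S)"
  have "?S ** right_pseudo_inverse ?S = mat 1"
    using matrix_inv_right_det[OF assms] by (simp add: right_pseudo_inverse_def matrix_mul_assoc)
  then have "(?S ** right_pseudo_inverse ?S) $ Inr i $ Inl m = 0"
    by (simp add: mat_def)
  then have "(\<Sum>l\<in>UNIV. B $ i $ l * ?f $ l) = 0"
    by (simp add: matrix_matrix_mult_def stack_rows_def column_def)
  then show ?thesis
    by (simp add: sps_precoder_def Let_def sum_divide_distrib[symmetric])
qed

section \<open>Almost sure full rank\<close>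

text \<open>
  Fubini and translation invariance: integrating the exceptional set along all lines parallel to \<open>D\<close>
  yields \<open>\<infinity>\<close> times its Lebesgue measure.
\<close>

lemma AE_lborel_lines:
  fixes D :: "'b::euclidean_space"
  assumes [measurable]: "Measurable.pred borel Q"
    and line: "\<And>x. AE t::real in lborel. Q (x + t *\<^sub>R D)"
  shows "AE x in lborel. Q x"
proof -
  let ?Z = "{x. \<not> Q x}"
  have [measurable]: "?Z \<in> sets borel"
    by measurable
  have "(\<integral>\<^sup>+t. \<integral>\<^sup>+x. indicator ?Z (x + t *\<^sub>R D) \<partial>lborel \<partial>(lborel :: real measure))
      = (\<integral>\<^sup>+x. \<integral>\<^sup>+t. indicator ?Z (x + t *\<^sub>R D) \<partial>(lborel :: real measure) \<partial>lborel)"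
    by (rule lborel_pair.Fubini') measurable
  also have "\<dots> = (\<integral>\<^sup>+x. 0 \<partial>(lborel :: 'b measure))"
  proof (rule nn_integral_cong)
    fix x :: 'b
    have "(\<integral>\<^sup>+t. indicator ?Z (x + t *\<^sub>R D) \<partial>(lborel :: real measure)) = (\<integral>\<^sup>+t. 0 \<partial>(lborel :: real measure))"
      using line[of x] by (intro nn_integral_cong_AE) (auto simp: indicator_def)
    then show "(\<integral>\<^sup>+t. indicator ?Z (x + t *\<^sub>R D) \<partial>(lborel :: real measure)) = 0"
      by simp
  qed
  finally have "(\<integral>\<^sup>+t. \<integral>\<^sup>+x. indicator ?Z (x + t *\<^sub>R D) \<partial>lborel \<partial>(lborel :: real measure)) = 0"
    by simp
  moreover have "(\<integral>\<^sup>+x. indicator ?Z (x + t *\<^sub>R D) \<partial>lborel) = emeasure lborel ?Z" for t :: real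
  proof -
    have "emeasure lborel ?Z = (\<integral>\<^sup>+x. indicator ?Z x \<partial>distr lborel borel ((+) (t *\<^sub>R D)))"
      by (subst lborel_distr_plus) simp
    also have "\<dots> = (\<integral>\<^sup>+x. indicator ?Z (t *\<^sub>R D + x) \<partial>lborel)"
      by (subst nn_integral_distr) auto
    finally show ?thesis
      by (simp add: add.commute)
  qed
  ultimately have "emeasure lborel ?Z = 0"
    by simp
  then show ?thesis
    by (subst AE_iff_measurable[OF _ refl]) auto
qed

text \<open>Given \<open>E = e\<close>, the variable \<open>H + e\<close> has a translated density
  and still avoids Lebesgue null sets; Fubini then averages over \<open>e\<close>. The law of
  \<open>E\<close> may be singular, such as a point mass.\<close>

lemma (in prob_space) AE_add_density:
  fixes H E :: "'a \<Rightarrow> 'b::euclidean_space"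
  assumes [measurable]: "H \<in> borel_measurable M" "E \<in> borel_measurable M"
    and ind: "indep_set (vimage_events M E borel) (vimage_events M H borel)"
    and H: "distr M borel H = density lborel f" and [measurable]: "f \<in> borel_measurable borel"
    and Q[measurable]: "Measurable.pred borel Q" and AE: "AE x in lborel. Q x"
  shows "AE \<omega> in M. Q (H \<omega> + E \<omega>)"
proof -
  have "prob_space (distr M borel H)" "prob_space (distr M borel E)"
    by (auto intro: prob_space_distr)
  then interpret pair_sigma_finite "distr M borel E" "distr M borel H"
    by (auto simp: pair_sigma_finite_def prob_space_imp_sigma_finite)
  have "AE h in distr M borel H. Q (h + e)" for e
  proof -
    have "AE x in distr lborel borel ((+) e). Q x"
      using AE by (subst lborel_distr_plus)
    then have "AE h in lborel. Q (h + e)"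
      by (subst (asm) AE_distr_iff) (auto simp: add.commute)
    then show ?thesis
      unfolding H by (subst AE_density) auto
  qed
  then have "AE p in distr M borel E \<Otimes>\<^sub>M distr M borel H. Q (snd p + fst p)"
  proof (intro AE_pair_measure)
    have "Measurable.pred (borel \<Otimes>\<^sub>M borel) (\<lambda>p. Q (snd p + fst p))"
      by measurable
    then show "{p \<in> space (distr M borel E \<Otimes>\<^sub>M distr M borel H). Q (snd p + fst p)}
        \<in> sets (distr M borel E \<Otimes>\<^sub>M distr M borel H)"
      by (simp add: pred_def space_pair_measure cong: sets_pair_measure_cong)
  qed auto
  then have "AE p in distr M (borel \<Otimes>\<^sub>M borel) (\<lambda>\<omega>. (E \<omega>, H \<omega>)). Q (snd p + fst p)"
    using ind by (subst distr_pair_eq_pair_measure) auto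
  then show ?thesis
    by (subst (asm) AE_distr_iff) auto
qed

lemma measurable_minor_nonzero:
  "Measurable.pred borel (\<lambda>p :: (complex ^ 'm::finite ^ 'd::finite) \<times> (complex ^ 'm ^ 'n::finite).
     det (\<chi> i j. stack_rows (fst p) (snd p) $ i $ h j) \<noteq> 0)"
proof -
  have "(\<lambda>p :: (complex ^ 'm ^ 'd) \<times> (complex ^ 'm ^ 'n). stack_rows (fst p) (snd p) $ i $ c)
      \<in> borel_measurable (borel \<Otimes>\<^sub>M borel)" for i c
    by (cases i) (simp_all add: stack_rows_def)
  then have "(\<lambda>p :: (complex ^ 'm ^ 'd) \<times> (complex ^ 'm ^ 'n).
      det (\<chi> i j. stack_rows (fst p) (snd p) $ i $ h j)) \<in> borel_measurable borel"
    unfolding borel_prod by (intro measurable_det) simp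
  then show ?thesis
    by measurable
qed

text \<open>Along the direction \<open>D\<close> the chosen block changes by multiples of the
  identity, so the minor vanishes at finitely many points of each line.\<close>

lemma AE_lborel_minor_nonzero:
  fixes h :: "'d::finite + 'n::finite \<Rightarrow> 'm::finite"
  assumes "inj h"
  shows "AE p in (lborel :: ((complex ^ 'm ^ 'd) \<times> (complex ^ 'm ^ 'n)) measure).
    det (\<chi> i j. stack_rows (fst p) (snd p) $ i $ h j) \<noteq> 0"
proof (rule AE_lborel_lines[OF measurable_minor_nonzero])
  fix x :: "(complex ^ 'm ^ 'd) \<times> (complex ^ 'm ^ 'n)"
  \<comment> \<open>The block of \<open>D\<close> on the columns \<open>h j\<close> is the identity
    because \<open>h\<close> is injective.\<close>
  define D :: "(complex ^ 'm ^ 'd) \<times> (complex ^ 'm ^ 'n)"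
    where "D = (\<chi> r c. if c = h (Inl r) then 1 else 0, \<chi> r c. if c = h (Inr r) then 1 else 0)"
  let ?A = "\<chi> i j. stack_rows (fst x) (snd x) $ i $ h j"
  let ?F = "{t. det (\<chi> i j. ?A $ i $ j + (if i = j then t else 0)) = 0}"
  have eq: "(\<chi> i j. stack_rows (fst (x + t *\<^sub>R D)) (snd (x + t *\<^sub>R D)) $ i $ h j)
      = (\<chi> i j. ?A $ i $ j + (if i = j then complex_of_real t else 0))" for t
    using inj_eq[OF assms]
    by (auto simp: vec_eq_iff stack_rows_def D_def of_real_def split: sum.split)
  have "finite (complex_of_real -` ?F)"
    by (rule finite_vimageI[OF finite_singular_shifts]) (simp add: inj_def)
  then show "AE t in lborel. det (\<chi> i j. stack_rows (fst (x + t *\<^sub>R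
      (\<chi> r c. if c = h (Inl r) then 1 else 0, \<chi> r c. if c = h (Inr r) then 1 else 0)))
      (snd (x + t *\<^sub>R (\<chi> r c. if c = h (Inl r) then 1 else 0, \<chi> r c. if c = h (Inr r) then 1 else 0))) $ i $ h j) \<noteq> 0"
    using AE_not_in[OF finite_imp_null_set_lborel, of "complex_of_real -` ?F"]
    unfolding D_def[symmetric] eq by simp
qed

section \<open>Moments\<close>

text \<open>Computed from the defining push-forward rather than a density, so that
  \<open>v = 0\<close> is covered: the squared modulus is \<open>v / 2\<close> times the sum of two
  squared standard normals.\<close>

lemma (in prob_space) CN_moments:
  assumes [measurable]: "Z \<in> borel_measurable M" and Z: "distr M borel Z = CN v" and v: "v \<ge> 0"
  shows "integrable M (\<lambda>\<omega>. (cmod (Z \<omega>))\<^sup>2)" "expectation Z = 0" "expectation (\<lambda>\<omega>. (cmod (Z \<omega>))\<^sup>2) = v"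
proof -
  let ?N = std_normal_distribution
  let ?T = "\<lambda>p. complex_of_real (sqrt (v / 2)) * Complex (fst p) (snd p)"
  interpret N: prob_space ?N
    by (rule prob_space_normal_density) simp
  interpret NN: pair_prob_space ?N ?N ..
  have fst: "distr (?N \<Otimes>\<^sub>M ?N) ?N fst = ?N"
    by (rule N.distr_pair_fst)
  have snd: "distr (?N \<Otimes>\<^sub>M ?N) ?N snd = ?N"
    by (subst NN.distr_pair_swap, subst distr_distr) (auto simp: comp_def split_beta' fst)
  have int: "integrable (?N \<Otimes>\<^sub>M ?N) (\<lambda>p. fst p ^ k)" "integrable (?N \<Otimes>\<^sub>M ?N) (\<lambda>p. snd p ^ k)"
    "(\<integral>p. fst p ^ k \<partial>(?N \<Otimes>\<^sub>M ?N)) = (\<integral>x. x ^ k \<partial>?N)" "(\<integral>p. snd p ^ k \<partial>(?N \<Otimes>\<^sub>M ?N)) = (\<integral>x. x ^ k \<partial>?N)" for k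
    using integrable_std_normal_distribution_moment[of k]
      integrable_distr_eq[of fst "?N \<Otimes>\<^sub>M ?N" ?N "\<lambda>x. x ^ k"] integral_distr[of fst "?N \<Otimes>\<^sub>M ?N" ?N "\<lambda>x. x ^ k"]
      integrable_distr_eq[of snd "?N \<Otimes>\<^sub>M ?N" ?N "\<lambda>x. x ^ k"] integral_distr[of snd "?N \<Otimes>\<^sub>M ?N" ?N "\<lambda>x. x ^ k"]
    by (auto simp: fst snd)
  have m1: "(\<integral>x. x \<partial>?N) = 0"
    using integral_std_normal_distribution_moment_odd[of 1] by simp
  have m2: "(\<integral>x. x\<^sup>2 \<partial>?N) = 1"
    using std_normal_distribution_even_moments_abs[of 1] by (simp add: fact_numeral)
  have [measurable]: "?T \<in> borel_measurable (?N \<Otimes>\<^sub>M ?N)"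
    by (simp add: Complex_eq)
  have CN: "CN v = distr (?N \<Otimes>\<^sub>M ?N) borel ?T"
    by (simp add: CN_def split_beta')
  have sq: "(cmod (?T p))\<^sup>2 = v / 2 * ((fst p)\<^sup>2 + (snd p)\<^sup>2)" for p
    using v by (simp add: norm_mult power_mult_distrib cmod_power2 del: of_real_divide)
  have i2: "integrable (CN v) (\<lambda>z. (cmod z)\<^sup>2)"
    unfolding CN by (subst integrable_distr_eq) (auto simp: sq int)
  have "integrable (distr M borel Z) (\<lambda>z. (cmod z)\<^sup>2)"
    unfolding Z by (rule i2)
  then show "integrable M (\<lambda>\<omega>. (cmod (Z \<omega>))\<^sup>2)"
    by (subst (asm) integrable_distr_eq) auto
  have "expectation (\<lambda>\<omega>. (cmod (Z \<omega>))\<^sup>2) = (\<integral>z. (cmod z)\<^sup>2 \<partial>CN v)"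
    unfolding Z[symmetric] by (subst integral_distr) auto
  also have "\<dots> = (\<integral>p. v / 2 * ((fst p)\<^sup>2 + (snd p)\<^sup>2) \<partial>(?N \<Otimes>\<^sub>M ?N))"
    unfolding CN by (subst integral_distr) (auto simp: sq)
  also have "\<dots> = v"
    using int[of 2] m2 by simp
  finally show "expectation (\<lambda>\<omega>. (cmod (Z \<omega>))\<^sup>2) = v" .
  have "expectation Z = (\<integral>z. z \<partial>CN v)"
    unfolding Z[symmetric] by (subst integral_distr) auto
  also have "\<dots> = (\<integral>p. ?T p \<partial>(?N \<Otimes>\<^sub>M ?N))"
    unfolding CN by (subst integral_distr) auto
  also have "\<dots> = complex_of_real (sqrt (v / 2)) * ((\<integral>p. complex_of_real (fst p) \<partial>(?N \<Otimes>\<^sub>M ?N))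
      + \<i> * (\<integral>p. complex_of_real (snd p) \<partial>(?N \<Otimes>\<^sub>M ?N)))"
    using int[of 1] by (simp add: Complex_eq)
  also have "\<dots> = 0"
    using int[of 1] m1 by simp
  finally show "expectation Z = 0" .
qed

lemma (in prob_space) CN_entries_moments:
  assumes [measurable]: "X \<in> borel_measurable M" and X: "indep_CN_entries M X v" and v: "\<And>r. v r \<ge> 0"
  shows "integrable M (\<lambda>\<omega>. (cmod (X \<omega> $ r $ c))\<^sup>2)" "expectation (\<lambda>\<omega>. X \<omega> $ r $ c) = 0"
    "expectation (\<lambda>\<omega>. X \<omega> $ r $ c * cnj (X \<omega> $ r $ d)) = (if c = d then complex_of_real (v r) else 0)"
proof -
  have law: "distr M borel (\<lambda>\<omega>. X \<omega> $ r $ c) = CN (v r)" for c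
    using X by (simp add: indep_CN_entries_def)
  have *: "integrable M (\<lambda>\<omega>. (cmod (X \<omega> $ r $ c))\<^sup>2)" "expectation (\<lambda>\<omega>. X \<omega> $ r $ c) = 0"
    "expectation (\<lambda>\<omega>. (cmod (X \<omega> $ r $ c))\<^sup>2) = v r" for c
    using CN_moments[OF _ law v] by auto
  then show "integrable M (\<lambda>\<omega>. (cmod (X \<omega> $ r $ c))\<^sup>2)" "expectation (\<lambda>\<omega>. X \<omega> $ r $ c) = 0"
    by auto
  show "expectation (\<lambda>\<omega>. X \<omega> $ r $ c * cnj (X \<omega> $ r $ d)) = (if c = d then complex_of_real (v r) else 0)"
  proof (cases "c = d")
    case True
    then show ?thesis
      using *(3)[of d] integral_complex_of_real[of M "\<lambda>\<omega>. (cmod (X \<omega> $ r $ d))\<^sup>2"]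
      by (simp add: complex_norm_square del: of_real_power)
  next
    case False
    \<comment> \<open>Conjugating just the entry \<open>(r, d)\<close> makes the product over the
      two indices equal to the required mixed product while keeping one independent family.\<close>
    define Z where "Z = (\<lambda>p \<omega>. if p = (r, d) then cnj (X \<omega> $ fst p $ snd p) else X \<omega> $ fst p $ snd p)"
    have int: "integrable M (\<lambda>\<omega>. X \<omega> $ r $ c)" for c
      using square_integrable_imp_integrable[of "\<lambda>\<omega>. cmod (X \<omega> $ r $ c)"] *(1)[of c]
      by (auto simp: integrable_norm_iff)
    have "indep_vars (\<lambda>_. borel) (\<lambda>p \<omega>. X \<omega> $ fst p $ snd p) UNIV"
      using X by (simp add: indep_CN_entries_def split_beta')
    then have "indep_vars (\<lambda>_. borel) (\<lambda>p \<omega>. X \<omega> $ fst p $ snd p) {(r, c), (r, d)}"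
      by (rule indep_vars_subset) auto
    then have "indep_vars (\<lambda>_. borel)
        (\<lambda>p \<omega>. (if p = (r, d) then cnj else (\<lambda>z. z)) (X \<omega> $ fst p $ snd p)) {(r, c), (r, d)}"
      by (rule indep_vars_compose2) auto
    then have "indep_vars (\<lambda>_. borel) Z {(r, c), (r, d)}"
      by (simp add: Z_def if_distribR)
    then have "expectation (\<lambda>\<omega>. \<Prod>p\<in>{(r, c), (r, d)}. Z p \<omega>) = (\<Prod>p\<in>{(r, c), (r, d)}. expectation (Z p))"
      using int by (intro indep_vars_lebesgue_integral) (auto simp: Z_def False)
    then show ?thesis
      using False *(2)[of c] by (simp add: Z_def)
  qed
qed

text \<open>Dominated through \<open>2 |f| |g| \<le> |f|^2 + |g|^2\<close>. Taking one of the
  functions constantly 1 also yields integrability of single factors.\<close>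

lemma (in prob_space) integrable_mult_cnj_bounded:
  fixes f g b :: "'a \<Rightarrow> complex"
  assumes [measurable]: "f \<in> borel_measurable M" "g \<in> borel_measurable M" "b \<in> borel_measurable M"
    and "integrable M (\<lambda>\<omega>. (cmod (f \<omega>))\<^sup>2)" "integrable M (\<lambda>\<omega>. (cmod (g \<omega>))\<^sup>2)"
    and b: "\<And>\<omega>. cmod (b \<omega>) \<le> 1"
  shows "integrable M (\<lambda>\<omega>. f \<omega> * cnj (g \<omega>) * b \<omega>)"
proof (rule Bochner_Integration.integrable_bound)
  show "integrable M (\<lambda>\<omega>. (cmod (f \<omega>))\<^sup>2 + (cmod (g \<omega>))\<^sup>2)"
    using assms by simp
  have "cmod (f \<omega>) * cmod (g \<omega>) * cmod (b \<omega>) \<le> (cmod (f \<omega>))\<^sup>2 + (cmod (g \<omega>))\<^sup>2" for \<omega>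
  proof -
    have "cmod (f \<omega>) * cmod (g \<omega>) * cmod (b \<omega>) \<le> cmod (f \<omega>) * cmod (g \<omega>)"
      using b by (simp add: mult_left_le)
    also have "\<dots> \<le> 2 * cmod (f \<omega>) * cmod (g \<omega>)"
      by simp
    also have "\<dots> \<le> (cmod (f \<omega>))\<^sup>2 + (cmod (g \<omega>))\<^sup>2"
      by (rule sum_squares_bound)
    finally show ?thesis .
  qed
  then show "AE \<omega> in M. norm (f \<omega> * cnj (g \<omega>) * b \<omega>) \<le> norm ((cmod (f \<omega>))\<^sup>2 + (cmod (g \<omega>))\<^sup>2)"
    by (intro AE_I2) (simp add: norm_mult)
qed simp

text \<open>The probabilistic core, separated from matrices. The covariance equals
  \<open>I k - v * q\<close>: its first part is the term missing from the sum, its second part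
  produces the \<open>- v\<close> in the result.\<close>

lemma (in prob_space) covariance_sum_orthogonal:
  fixes e y w g :: "'m::finite \<Rightarrow> 'a \<Rightarrow> complex" and c v s :: real
  assumes [measurable]: "\<And>l. e l \<in> borel_measurable M" "\<And>l. y l \<in> borel_measurable M"
      "\<And>l. w l \<in> borel_measurable M" "\<And>l. g l \<in> borel_measurable M"
    and e: "\<And>l \<omega>. e l \<omega> = w l \<omega> + c * y l \<omega>"
    and sq: "\<And>l. integrable M (\<lambda>\<omega>. (cmod (e l \<omega>))\<^sup>2)" "\<And>l. integrable M (\<lambda>\<omega>. (cmod (y l \<omega>))\<^sup>2)"
      "\<And>l. integrable M (\<lambda>\<omega>. (cmod (w l \<omega>))\<^sup>2)"
    and g: "\<And>l \<omega>. cmod (g l \<omega>) \<le> 1"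
    and orth: "AE \<omega> in M. (\<Sum>l\<in>UNIV. y l \<omega> * g l \<omega>) = 0"
    and ind1: "\<And>l. indep_var borel (\<lambda>\<omega>. y k \<omega> * (g k \<omega> * cnj (g l \<omega>))) borel (\<lambda>\<omega>. cnj (w l \<omega>))"
    and ind2: "\<And>l. indep_var borel (\<lambda>\<omega>. g k \<omega> * cnj (g l \<omega>)) borel (\<lambda>\<omega>. w k \<omega> * cnj (w l \<omega>))"
    and w0: "\<And>l. expectation (w l) = 0"
    and w2: "\<And>l. expectation (\<lambda>\<omega>. w k \<omega> * cnj (w l \<omega>)) = (if k = l then complex_of_real s else 0)"
    and v: "expectation (\<lambda>\<omega>. (cmod (e k \<omega>))\<^sup>2) = v"
  shows "complex_of_real (covariance M (\<lambda>\<omega>. (cmod (e k \<omega>))\<^sup>2) (\<lambda>\<omega>. (cmod (g k \<omega>))\<^sup>2))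
    + (\<Sum>l\<in>UNIV - {k}. expectation (\<lambda>\<omega>. e k \<omega> * cnj (e l \<omega>) * g k \<omega> * cnj (g l \<omega>)))
    = complex_of_real ((s - v) * expectation (\<lambda>\<omega>. (cmod (g k \<omega>))\<^sup>2))"
proof -
  define I where "I l = expectation (\<lambda>\<omega>. e k \<omega> * cnj (e l \<omega>) * (g k \<omega> * cnj (g l \<omega>)))" for l
  define q where "q = expectation (\<lambda>\<omega>. (cmod (g k \<omega>))\<^sup>2)"
  have gg: "cmod (g k \<omega> * cnj (g l \<omega>)) \<le> 1" for l \<omega>
    using g by (simp add: norm_mult mult_le_one)
  have int_one: "integrable M (\<lambda>\<omega>. (cmod ((\<lambda>_. 1) \<omega>))\<^sup>2)"
    by simp
  have int_g2: "integrable M (\<lambda>\<omega>. (cmod (g k \<omega>))\<^sup>2)"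
    using g by (intro integrable_const_bound[of _ 1]) (auto simp: power_le_one)
  have gk: "g k \<omega> * cnj (g k \<omega>) = complex_of_real ((cmod (g k \<omega>))\<^sup>2)" for \<omega>
    by (rule complex_norm_square[symmetric])
  have gk_q: "expectation (\<lambda>\<omega>. g k \<omega> * cnj (g k \<omega>)) = complex_of_real q"
    unfolding gk q_def by (rule integral_complex_of_real)
  have int_eg: "integrable M (\<lambda>\<omega>. (cmod (e k \<omega>))\<^sup>2 * (cmod (g k \<omega>))\<^sup>2)"
    by (rule Bochner_Integration.integrable_bound[OF sq(1)[of k]])
       (use g in \<open>auto simp: abs_mult intro!: AE_I2 mult_left_le power_le_one\<close>)
  have "covariance M (\<lambda>\<omega>. (cmod (e k \<omega>))\<^sup>2) (\<lambda>\<omega>. (cmod (g k \<omega>))\<^sup>2)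
      = expectation (\<lambda>\<omega>. (cmod (e k \<omega>))\<^sup>2 * (cmod (g k \<omega>))\<^sup>2 - v * (cmod (g k \<omega>))\<^sup>2
          - q * (cmod (e k \<omega>))\<^sup>2 + v * q)"
    unfolding covariance_def v q_def[symmetric] by (simp add: algebra_simps)
  also have "\<dots> = expectation (\<lambda>\<omega>. (cmod (e k \<omega>))\<^sup>2 * (cmod (g k \<omega>))\<^sup>2) - v * q - q * v + v * q"
    using int_eg int_g2 sq(1)[of k] v by (simp add: q_def prob_space)
  finally have cov: "covariance M (\<lambda>\<omega>. (cmod (e k \<omega>))\<^sup>2) (\<lambda>\<omega>. (cmod (g k \<omega>))\<^sup>2)
      = expectation (\<lambda>\<omega>. (cmod (e k \<omega>))\<^sup>2 * (cmod (g k \<omega>))\<^sup>2) - v * q"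
    by simp
  have "complex_of_real (expectation (\<lambda>\<omega>. (cmod (e k \<omega>))\<^sup>2 * (cmod (g k \<omega>))\<^sup>2)) = I k"
    unfolding I_def gk by (subst integral_complex_of_real[symmetric])
      (simp add: complex_norm_square mult_ac del: of_real_power)
  with cov have "complex_of_real (covariance M (\<lambda>\<omega>. (cmod (e k \<omega>))\<^sup>2) (\<lambda>\<omega>. (cmod (g k \<omega>))\<^sup>2))
    + (\<Sum>l\<in>UNIV - {k}. expectation (\<lambda>\<omega>. e k \<omega> * cnj (e l \<omega>) * g k \<omega> * cnj (g l \<omega>)))
    = (\<Sum>l\<in>UNIV. I l) - complex_of_real (v * q)"
    by (subst sum.remove[of UNIV k]) (auto simp: I_def mult.assoc)
  also have "(\<Sum>l\<in>UNIV. I l) = expectation (\<lambda>\<omega>. \<Sum>l\<in>UNIV. e k \<omega> * cnj (e l \<omega>) * (g k \<omega> * cnj (g l \<omega>)))"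
    unfolding I_def by (rule Bochner_Integration.integral_sum[symmetric])
      (intro integrable_mult_cnj_bounded sq gg; measurable)
  \<comment> \<open>Only the conjugated factor \<open>e l\<close> is summed against
    \<open>g l\<close>, so orthogonality replaces it by \<open>w l\<close>; the factor
    \<open>e k\<close> lies outside that sum and stays.\<close>
  also have "\<dots> = expectation (\<lambda>\<omega>. \<Sum>l\<in>UNIV. e k \<omega> * cnj (w l \<omega>) * (g k \<omega> * cnj (g l \<omega>)))"
  proof (rule integral_cong_AE)
    show "AE \<omega> in M. (\<Sum>l\<in>UNIV. e k \<omega> * cnj (e l \<omega>) * (g k \<omega> * cnj (g l \<omega>)))
        = (\<Sum>l\<in>UNIV. e k \<omega> * cnj (w l \<omega>) * (g k \<omega> * cnj (g l \<omega>)))"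
      using orth
    proof eventually_elim
      case (elim \<omega>)
      have "(\<Sum>l\<in>UNIV. e k \<omega> * cnj (e l \<omega>) * (g k \<omega> * cnj (g l \<omega>)))
          = (\<Sum>l\<in>UNIV. e k \<omega> * cnj (w l \<omega>) * (g k \<omega> * cnj (g l \<omega>)))
            + e k \<omega> * g k \<omega> * c * cnj (\<Sum>l\<in>UNIV. y l \<omega> * g l \<omega>)"
        unfolding e[of _ \<omega>] by (simp add: sum.distrib[symmetric] sum_distrib_left algebra_simps)
      then show ?case
        using elim by simp
    qed
  qed measurable
  also have "\<dots> = (\<Sum>l\<in>UNIV. expectation (\<lambda>\<omega>. e k \<omega> * cnj (w l \<omega>) * (g k \<omega> * cnj (g l \<omega>))))"
    by (rule Bochner_Integration.integral_sum)
      (intro integrable_mult_cnj_bounded sq gg; measurable)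
  \<comment> \<open>Now \<open>e k\<close> is split into \<open>w k + c * y k\<close>. The second
    part vanishes since \<open>w l\<close> is centred and independent of \<open>y\<close> and
    \<open>g\<close>; the first leaves the covariance of \<open>w k\<close> and
    \<open>w l\<close>.\<close>
  also have "\<dots> = (\<Sum>l\<in>UNIV. if k = l then complex_of_real (s * q) else 0)"
  proof (rule sum.cong[OF refl])
    fix l
    have i1: "integrable M (\<lambda>\<omega>. y k \<omega> * (g k \<omega> * cnj (g l \<omega>)))"
      using integrable_mult_cnj_bounded[OF _ _ _ sq(2)[of k] int_one gg[of _ l]] by simp
    have i2: "integrable M (\<lambda>\<omega>. cnj (w l \<omega>))"
      using integrable_mult_cnj_bounded[OF _ _ _ int_one sq(3)[of l], of "\<lambda>_. 1"] by simp
    have i3: "integrable M (\<lambda>\<omega>. w k \<omega> * cnj (w l \<omega>))"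
      using integrable_mult_cnj_bounded[OF _ _ _ sq(3)[of k] sq(3)[of l], of "\<lambda>_. 1"] by simp
    have i4: "integrable M (\<lambda>\<omega>. g k \<omega> * cnj (g l \<omega>))"
      using gg by (intro integrable_const_bound[of _ 1]) auto
    have "(\<lambda>\<omega>. e k \<omega> * cnj (w l \<omega>) * (g k \<omega> * cnj (g l \<omega>)))
        = (\<lambda>\<omega>. c * (y k \<omega> * (g k \<omega> * cnj (g l \<omega>)) * cnj (w l \<omega>))
            + (g k \<omega> * cnj (g l \<omega>)) * (w k \<omega> * cnj (w l \<omega>)))"
      unfolding e by (simp add: fun_eq_iff algebra_simps)
    then have "expectation (\<lambda>\<omega>. e k \<omega> * cnj (w l \<omega>) * (g k \<omega> * cnj (g l \<omega>)))
        = c * expectation (\<lambda>\<omega>. y k \<omega> * (g k \<omega> * cnj (g l \<omega>)) * cnj (w l \<omega>))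
          + expectation (\<lambda>\<omega>. (g k \<omega> * cnj (g l \<omega>)) * (w k \<omega> * cnj (w l \<omega>)))"
      using indep_var_integrable[OF ind1 i1 i2] indep_var_integrable[OF ind2 i4 i3]
      by simp
    also have "\<dots> = c * (expectation (\<lambda>\<omega>. y k \<omega> * (g k \<omega> * cnj (g l \<omega>))) * expectation (\<lambda>\<omega>. cnj (w l \<omega>)))
        + expectation (\<lambda>\<omega>. g k \<omega> * cnj (g l \<omega>)) * (if k = l then complex_of_real s else 0)"
      using indep_var_lebesgue_integral[OF ind1 i1 i2] indep_var_lebesgue_integral[OF ind2 i4 i3] w2
      by simp
    also have "expectation (\<lambda>\<omega>. cnj (w l \<omega>)) = 0"
      using w0[of l] by simp
    finally show "expectation (\<lambda>\<omega>. e k \<omega> * cnj (w l \<omega>) * (g k \<omega> * cnj (g l \<omega>)))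
        = (if k = l then complex_of_real (s * q) else 0)"
      using gk_q by auto
  qed
  finally show ?thesis
    by (simp add: q_def algebra_simps)
qed

theorem lemma3:
  fixes P :: "'a measure"
    and H_DL E_DL :: "'a \<Rightarrow> complex ^ 'm::finite ^ 'd::finite"
    and H_SI E_SI :: "'a \<Rightarrow> complex ^ 'm ^ 'n::finite"
    and eps_DL :: "'d \<Rightarrow> real" and eps_SI :: real
    and G :: "'a \<Rightarrow> complex ^ 'd ^ 'm"
    and i :: 'n and k :: 'm and m :: 'd
  assumes "prob_space P"
    and "CARD('m) \<ge> CARD('n) + CARD('d)"
    and "eps_SI > 0"
    and "indep_CN_entries P H_DL (\<lambda>_. 1)"
    and "indep_CN_entries P H_SI (\<lambda>_. 1)"
    and "indep_CN_entries P E_DL (\<lambda>r. (eps_DL r)\<^sup>2)"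
    and "indep_CN_entries P E_SI (\<lambda>_. eps_SI\<^sup>2)"
    and "prob_space.indep_sets P
           (\<lambda>j::nat. [events_of P H_DL, events_of P H_SI, events_of P E_DL, events_of P E_SI] ! j) {..<4}"
    and "\<And>\<omega>. G \<omega> = sps_precoder (H_DL \<omega> + E_DL \<omega>) (H_SI \<omega> + E_SI \<omega>)"
  shows "complex_of_real
           (covariance P (\<lambda>\<omega>. (cmod (E_SI \<omega> $ i $ k))\<^sup>2) (\<lambda>\<omega>. (cmod (G \<omega> $ k $ m))\<^sup>2))
         + (\<Sum>l\<in>UNIV - {k}. integral\<^sup>L P
              (\<lambda>\<omega>. E_SI \<omega> $ i $ k * cnj (E_SI \<omega> $ i $ l) * G \<omega> $ k $ m * cnj (G \<omega> $ l $ m)))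
         \<le> 0"
proof -
  interpret prob_space P by fact
  let ?E = "\<lambda>j::nat. [events_of P H_DL, events_of P H_SI, events_of P E_DL, events_of P E_SI] ! j"
  define v where "v = eps_SI\<^sup>2"
  have v: "v > 0"
    using assms(3) by (simp add: v_def)
  define c where "c = v / (1 + v)"
  define D where "D \<omega> = H_DL \<omega> + E_DL \<omega>" for \<omega>
  define Y where "Y \<omega> = H_SI \<omega> + E_SI \<omega>" for \<omega>
  define W where "W \<omega> = E_SI \<omega> - c *\<^sub>R Y \<omega>" for \<omega>
  note ind = assms(8)
  have E_simps: "?E 0 = events_of P H_DL" "?E 1 = events_of P H_SI" "?E 2 = events_of P E_DL"
    "?E 3 = events_of P E_SI"
    by (simp_all add: numeral_eq_Suc)
  have idx: "{..<4::nat} = {0, 1, 2, 3}"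
    by auto
  \<comment> \<open>Independence of families includes that their members are events; this is where
    measurability of the four matrices comes from.\<close>
  have ev: "events_of P H_DL \<subseteq> events" "events_of P H_SI \<subseteq> events"
    "events_of P E_DL \<subseteq> events" "events_of P E_SI \<subseteq> events"
    using ind E_simps unfolding indep_sets_def idx by auto
  have rv: "X \<in> borel_measurable P" if "events_of P X \<subseteq> events" for X :: "'a \<Rightarrow> 'x::topological_space"
    using that by (auto intro!: measurableI simp: events_of_def)
  have H_DL[measurable]: "H_DL \<in> borel_measurable P" and H_SI[measurable]: "H_SI \<in> borel_measurable P"
    and E_DL[measurable]: "E_DL \<in> borel_measurable P" and E_SI[measurable]: "E_SI \<in> borel_measurable P"
    using ev by (auto intro: rv)
  have stable: "Int_stable (?E j)" if "j \<in> {..<4}" for j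
    using that E_simps unfolding idx by (auto simp: events_of_eq_vimage_events Int_stable_vimage_events)
  have E_sub: "?E j \<subseteq> Pow (space P)" if "j \<in> {..<4}" for j
    using that E_simps unfolding idx by (auto simp: events_of_def)
  have group: "X \<in> borel_measurable (sigma (space P) (\<Union>j\<in>J. ?E j))"
    if "X \<in> borel_measurable P" "j \<in> J" "J \<subseteq> {..<4}" "?E j = events_of P X" for X :: "'a \<Rightarrow> 'x::topological_space" and j J
  proof (rule measurable_sigma_vimage_events)
    show "vimage_events P X borel \<subseteq> (\<Union>j\<in>J. ?E j)"
      using that(2,4) by (auto simp: events_of_eq_vimage_events)
    show "(\<Union>j\<in>J. ?E j) \<subseteq> Pow (space P)"
      using that(3) E_sub by blast
  qed fact
  note group_H_DL = group[OF H_DL _ _ E_simps(1)] and group_H_SI = group[OF H_SI _ _ E_simps(2)]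
    and group_E_DL = group[OF E_DL _ _ E_simps(3)] and group_E_SI = group[OF E_SI _ _ E_simps(4)]
  note groups = indep_set_vimage_groups[OF ind _ _ stable]

  \<comment> \<open>Independence of channels, errors, estimates and residual\<close>
  have ind_SI: "indep_set (vimage_events P H_SI borel) (vimage_events P E_SI borel)"
    by (rule groups[of "{1}" "{3}"])
       (rule group_H_SI group_E_SI | simp; fail)+
  have ind_HE: "indep_set (vimage_events P (\<lambda>\<omega>. (E_DL \<omega>, E_SI \<omega>)) borel)
      (vimage_events P (\<lambda>\<omega>. (H_DL \<omega>, H_SI \<omega>)) borel)"
    unfolding borel_prod[symmetric]
    by (rule groups[of "{2, 3}" "{0, 1}"])
       (rule measurable_Pair group_H_DL group_H_SI group_E_DL group_E_SI | simp; fail)+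
  have ind_H: "indep_set (vimage_events P H_DL borel) (vimage_events P H_SI borel)"
    by (rule groups[of "{0}" "{1}"])
       (rule group_H_DL group_H_SI | simp; fail)+
  have ind_D: "indep_set (vimage_events P D borel) (vimage_events P (\<lambda>\<omega>. (Y \<omega>, W \<omega>)) (borel \<Otimes>\<^sub>M borel))"
  proof (rule groups[of "{0, 2}" "{1, 3}"])
    have [measurable]: "H_DL \<in> borel_measurable (sigma (space P) (\<Union>j\<in>{0, 2}. ?E j))"
      "E_DL \<in> borel_measurable (sigma (space P) (\<Union>j\<in>{0, 2}. ?E j))"
      "H_SI \<in> borel_measurable (sigma (space P) (\<Union>j\<in>{1, 3}. ?E j))"
      "E_SI \<in> borel_measurable (sigma (space P) (\<Union>j\<in>{1, 3}. ?E j))"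
      by (rule group_H_DL group_E_DL group_H_SI group_E_SI; simp)+
    show "D \<in> borel_measurable (sigma (space P) (\<Union>j\<in>{0, 2}. ?E j))"
      unfolding D_def by measurable
    show "(\<lambda>\<omega>. (Y \<omega>, W \<omega>)) \<in> measurable (sigma (space P) (\<Union>j\<in>{1, 3}. ?E j)) (borel \<Otimes>\<^sub>M borel)"
      unfolding W_def Y_def by measurable
  qed auto
  have [measurable]: "D \<in> borel_measurable P" "Y \<in> borel_measurable P" "W \<in> borel_measurable P"
    unfolding W_def D_def Y_def by measurable

  obtain a where a: "a \<ge> 0" "distr P borel H_SI = density lborel (\<lambda>x. ennreal (a * exp (- (norm x)\<^sup>2 / 1)))"
    using distr_indep_CN_entries[OF assms(5)] by auto
  obtain a' where a': "a' \<ge> 0" "distr P borel H_DL = density lborel (\<lambda>x. ennreal (a' * exp (- (norm x)\<^sup>2 / 1)))"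
    using distr_indep_CN_entries[OF assms(4)] by auto
  obtain b where b: "b \<ge> 0" "distr P borel E_SI = density lborel (\<lambda>x. ennreal (b * exp (- (norm x)\<^sup>2 / v)))"
    using distr_indep_CN_entries[OF assms(7)] v by (auto simp: v_def)
  have "indep_set (vimage_events P Y borel) (vimage_events P W borel)"
    using indep_gaussian_regression[OF H_SI E_SI ind_SI a(2) b(2) a(1) b(1) v]
    unfolding Y_def W_def c_def .
  \<comment> \<open>The regression separates \<open>Y\<close> from \<open>W\<close>, and the
    grouping separates \<open>D\<close> from both; together the residual is independent of
    everything the precoder sees.\<close>
  then have ind_W: "indep_set (vimage_events P (\<lambda>\<omega>. (D \<omega>, Y \<omega>)) (borel \<Otimes>\<^sub>M borel)) (vimage_events P W borel)"
    using ind_D by (intro indep_set_pair_assoc) auto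

  \<comment> \<open>Full rank of the stacked estimate\<close>
  have "card (UNIV :: ('d + 'n) set) \<le> card (UNIV :: 'm set)"
    using assms(2) by simp
  \<comment> \<open>The dimension condition enters here: \<open>h\<close> selects distinct columns,
    one for each row, and hence a maximal minor.\<close>
  then obtain h :: "'d + 'n \<Rightarrow> 'm" where h: "inj h"
    using card_le_inj[of "UNIV :: ('d + 'n) set" "UNIV :: 'm set"] by auto
  have sf: "sigma_finite_measure (distr P borel H_SI)"
    by (intro prob_space_imp_sigma_finite prob_space_distr) simp
  have law_H: "distr P borel (\<lambda>\<omega>. (H_DL \<omega>, H_SI \<omega>)) = density lborel
      (\<lambda>(x, y). ennreal (a' * exp (- (norm x)\<^sup>2 / 1)) * ennreal (a * exp (- (norm y)\<^sup>2 / 1)))"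
  proof -
    have "distr P borel (\<lambda>\<omega>. (H_DL \<omega>, H_SI \<omega>)) = distr P borel H_DL \<Otimes>\<^sub>M distr P borel H_SI"
      unfolding borel_prod[symmetric] by (rule distr_pair_eq_pair_measure) (use ind_H in auto)
    then show ?thesis
      using sf unfolding a(2) a'(2) lborel_prod[symmetric]
      by (subst (asm) pair_measure_density) (auto intro: lborel.sigma_finite_measure_axioms)
  qed
  have "AE \<omega> in P. det (\<chi> p q. stack_rows (fst ((H_DL \<omega>, H_SI \<omega>) + (E_DL \<omega>, E_SI \<omega>)))
      (snd ((H_DL \<omega>, H_SI \<omega>) + (E_DL \<omega>, E_SI \<omega>))) $ p $ h q) \<noteq> 0"
  proof (rule AE_add_density[OF _ _ ind_HE law_H _ _ AE_lborel_minor_nonzero[OF h]])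
    show "(\<lambda>\<omega>. (H_DL \<omega>, H_SI \<omega>)) \<in> borel_measurable P" "(\<lambda>\<omega>. (E_DL \<omega>, E_SI \<omega>)) \<in> borel_measurable P"
      unfolding borel_prod[symmetric] by measurable
    show "(\<lambda>(x :: complex ^ 'm ^ 'd, y :: complex ^ 'm ^ 'n).
        ennreal (a' * exp (- (norm x)\<^sup>2 / 1)) * ennreal (a * exp (- (norm y)\<^sup>2 / 1))) \<in> borel_measurable borel"
      unfolding borel_prod[symmetric] by measurable
  qed (rule measurable_minor_nonzero)
  then have minor: "AE \<omega> in P. det (\<chi> p q. stack_rows (D \<omega>) (Y \<omega>) $ p $ h q) \<noteq> 0"
    by (simp add: D_def Y_def)

  define g where "g l \<omega> = sps_precoder (D \<omega>) (Y \<omega>) $ l $ m" for l \<omega>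
  have G: "G \<omega> $ l $ m = g l \<omega>" for l \<omega>
    by (simp add: g_def D_def Y_def assms(9))
  have orth: "AE \<omega> in P. (\<Sum>l\<in>UNIV. Y \<omega> $ i $ l * g l \<omega>) = 0"
    using minor unfolding g_def by eventually_elim (intro sps_precoder_orthogonal det_gram_nonzero)
  have [measurable]: "g l \<in> borel_measurable P" for l
    unfolding g_def by (rule measurable_sps_precoder) measurable
  have [measurable]: "(\<lambda>p. sps_precoder (fst p) (snd p) $ l $ m) \<in>
      borel_measurable (borel \<Otimes>\<^sub>M borel :: ((complex ^ 'm ^ 'd) \<times> (complex ^ 'm ^ 'n)) measure)" for l
    by (rule measurable_sps_precoder) measurable
  \<comment> \<open>The factors containing the precoder are functions of \<open>(D, Y)\<close>, the
    residual factors are functions of \<open>W\<close>.\<close>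
  have ind_fg: "indep_var borel (\<lambda>\<omega>. f1 (D \<omega>, Y \<omega>)) borel (\<lambda>\<omega>. f2 (W \<omega>))"
    if [measurable]: "f1 \<in> borel_measurable (borel \<Otimes>\<^sub>M borel)" "f2 \<in> borel_measurable borel"
    for f1 :: "_ \<Rightarrow> complex" and f2 :: "_ \<Rightarrow> complex"
    unfolding indep_var_iff_vimage_events
    by (intro conjI indep_set_vimage_comp[OF ind_W]) measurable
  have ind1: "indep_var borel (\<lambda>\<omega>. Y \<omega> $ i $ k * (g k \<omega> * cnj (g l \<omega>))) borel (\<lambda>\<omega>. cnj (W \<omega> $ i $ l))" for l
    using ind_fg[of "\<lambda>p. snd p $ i $ k * (sps_precoder (fst p) (snd p) $ k $ m * cnj (sps_precoder (fst p) (snd p) $ l $ m))"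
        "\<lambda>w. cnj (w $ i $ l)"]
    by (simp add: g_def)
  have ind2: "indep_var borel (\<lambda>\<omega>. g k \<omega> * cnj (g l \<omega>)) borel (\<lambda>\<omega>. W \<omega> $ i $ k * cnj (W \<omega> $ i $ l))" for l
    using ind_fg[of "\<lambda>p. sps_precoder (fst p) (snd p) $ k $ m * cnj (sps_precoder (fst p) (snd p) $ l $ m)"
        "\<lambda>w. w $ i $ k * cnj (w $ i $ l)"]
    by (simp add: g_def)

  \<comment> \<open>Moments of the residual row\<close>
  note mH = CN_entries_moments[OF H_SI assms(5)] and mE = CN_entries_moments[OF E_SI assms(7)[folded v_def]]
  have mH': "integrable P (\<lambda>\<omega>. (cmod (H_SI \<omega> $ i $ l))\<^sup>2)" "expectation (\<lambda>\<omega>. H_SI \<omega> $ i $ l) = 0"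
    "expectation (\<lambda>\<omega>. H_SI \<omega> $ i $ l * cnj (H_SI \<omega> $ i $ l')) = (if l = l' then 1 else 0)" for l l'
    using mH[of i l] by auto
  have mE': "integrable P (\<lambda>\<omega>. (cmod (E_SI \<omega> $ i $ l))\<^sup>2)" "expectation (\<lambda>\<omega>. E_SI \<omega> $ i $ l) = 0"
    "expectation (\<lambda>\<omega>. E_SI \<omega> $ i $ l * cnj (E_SI \<omega> $ i $ l')) = (if l = l' then complex_of_real v else 0)" for l l'
    using mE[of i l] v by auto
  have int_cross: "integrable P (\<lambda>\<omega>. X \<omega> * cnj (X' \<omega>))"
    if [measurable]: "X \<in> borel_measurable P" "X' \<in> borel_measurable P"
      and "integrable P (\<lambda>\<omega>. (cmod (X \<omega>))\<^sup>2)" "integrable P (\<lambda>\<omega>. (cmod (X' \<omega>))\<^sup>2)" for X X' :: "'a \<Rightarrow> complex"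
    using integrable_mult_cnj_bounded[of X X' "\<lambda>_. 1"] that by simp
  have int: "integrable P X"
    if [measurable]: "X \<in> borel_measurable P" and "integrable P (\<lambda>\<omega>. (cmod (X \<omega>))\<^sup>2)" for X :: "'a \<Rightarrow> complex"
    using int_cross[of X "\<lambda>_. 1"] that by simp
  have int1: "integrable P (\<lambda>\<omega>. H_SI \<omega> $ i $ l)" "integrable P (\<lambda>\<omega>. E_SI \<omega> $ i $ l)" for l
    using mH' mE' by (auto intro!: int)
  have ind_he: "indep_var borel (\<lambda>\<omega>. H_SI \<omega> $ i $ l) borel (\<lambda>\<omega>. cnj (E_SI \<omega> $ i $ l'))" for l l'
    unfolding indep_var_iff_vimage_events
    by (intro conjI indep_set_vimage_comp[OF ind_SI]) measurable
  have he: "expectation (\<lambda>\<omega>. H_SI \<omega> $ i $ l * cnj (E_SI \<omega> $ i $ l')) = 0" for l l'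
    using int1 mH' by (subst indep_var_lebesgue_integral[OF ind_he]) auto
  have eh: "expectation (\<lambda>\<omega>. E_SI \<omega> $ i $ l * cnj (H_SI \<omega> $ i $ l')) = 0" for l l'
    using Bochner_Integration.integral_cnj[of P "\<lambda>\<omega>. H_SI \<omega> $ i $ l' * cnj (E_SI \<omega> $ i $ l)"] he[of l' l]
    by (simp add: mult.commute)
  have W: "W \<omega> $ i $ l = (1 - c) * E_SI \<omega> $ i $ l - c * H_SI \<omega> $ i $ l" for \<omega> l
    by (simp add: W_def Y_def algebra_simps scaleR_conv_of_real[where 'a=complex])
  \<comment> \<open>The variance of an entry of \<open>W = (1 - c) E - c H\<close>, whose two parts
    are uncorrelated with entry variances \<open>v\<close> and 1.\<close>
  define s where "s = (1 - c)\<^sup>2 * v + c\<^sup>2"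
  have W0: "expectation (\<lambda>\<omega>. W \<omega> $ i $ l) = 0" for l
    unfolding W using int1 mH' mE' by simp
  have WW: "W \<omega> $ i $ l * cnj (W \<omega> $ i $ l')
      = (1 - c)\<^sup>2 * (E_SI \<omega> $ i $ l * cnj (E_SI \<omega> $ i $ l')) - (1 - c) * c * (E_SI \<omega> $ i $ l * cnj (H_SI \<omega> $ i $ l'))
        - (1 - c) * c * (H_SI \<omega> $ i $ l * cnj (E_SI \<omega> $ i $ l')) + c\<^sup>2 * (H_SI \<omega> $ i $ l * cnj (H_SI \<omega> $ i $ l'))" for \<omega> l l'
    unfolding W by (simp add: algebra_simps power2_eq_square)
  have ints: "integrable P (\<lambda>\<omega>. E_SI \<omega> $ i $ l * cnj (E_SI \<omega> $ i $ l'))" "integrable P (\<lambda>\<omega>. E_SI \<omega> $ i $ l * cnj (H_SI \<omega> $ i $ l'))"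
    "integrable P (\<lambda>\<omega>. H_SI \<omega> $ i $ l * cnj (E_SI \<omega> $ i $ l'))" "integrable P (\<lambda>\<omega>. H_SI \<omega> $ i $ l * cnj (H_SI \<omega> $ i $ l'))" for l l'
    using mH' mE' by (auto intro!: int_cross)
  have W2: "expectation (\<lambda>\<omega>. W \<omega> $ i $ l * cnj (W \<omega> $ i $ l')) = (if l = l' then complex_of_real s else 0)" for l l'
    unfolding WW using ints mH' mE' he eh by (simp add: s_def)
  have sq_of: "integrable P (\<lambda>\<omega>. (cmod (X \<omega>))\<^sup>2)" if "integrable P (\<lambda>\<omega>. X \<omega> * cnj (X \<omega>))" for X :: "'a \<Rightarrow> complex"
    using that integrable_Re[OF that] by (simp add: complex_norm_square[symmetric] del: of_real_power)
  have sqW: "integrable P (\<lambda>\<omega>. (cmod (W \<omega> $ i $ l))\<^sup>2)" for l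
    by (rule sq_of) (unfold WW, use ints in simp)
  have sqY: "integrable P (\<lambda>\<omega>. (cmod (Y \<omega> $ i $ l))\<^sup>2)" for l
    by (rule sq_of) (use ints in \<open>simp add: Y_def algebra_simps\<close>)
  have vE: "expectation (\<lambda>\<omega>. (cmod (E_SI \<omega> $ i $ k))\<^sup>2) = v"
    using mE'(3)[of k k] unfolding complex_norm_square[symmetric] integral_complex_of_real by simp

  have "complex_of_real
           (covariance P (\<lambda>\<omega>. (cmod (E_SI \<omega> $ i $ k))\<^sup>2) (\<lambda>\<omega>. (cmod (g k \<omega>))\<^sup>2))
         + (\<Sum>l\<in>UNIV - {k}. integral\<^sup>L P
              (\<lambda>\<omega>. E_SI \<omega> $ i $ k * cnj (E_SI \<omega> $ i $ l) * g k \<omega> * cnj (g l \<omega>)))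
      = complex_of_real ((s - v) * expectation (\<lambda>\<omega>. (cmod (g k \<omega>))\<^sup>2))"
  proof (rule covariance_sum_orthogonal[where y = "\<lambda>l \<omega>. Y \<omega> $ i $ l" and w = "\<lambda>l \<omega>. W \<omega> $ i $ l" and c = c])
    show "E_SI \<omega> $ i $ l = W \<omega> $ i $ l + c * Y \<omega> $ i $ l" for l \<omega>
      by (simp add: W_def scaleR_conv_of_real[where 'a=complex])
    show "cmod (g l \<omega>) \<le> 1" for l \<omega>
      unfolding g_def by (rule cmod_sps_precoder_le)
    show "(\<lambda>\<omega>. E_SI \<omega> $ i $ l) \<in> borel_measurable P" "(\<lambda>\<omega>. Y \<omega> $ i $ l) \<in> borel_measurable P"
      "(\<lambda>\<omega>. W \<omega> $ i $ l) \<in> borel_measurable P" "g l \<in> borel_measurable P" for l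
      by measurable
  qed (fact orth ind1 ind2 W0 W2 vE sqW sqY mE'(1))+
  moreover have "s \<le> v"
  proof -
    have "1 - c = 1 / (1 + v)"
      using v by (simp add: c_def field_simps)
    \<comment> \<open>\<open>(1 - c)^2 v + c^2 = (v + v^2) / (1 + v)^2 = v / (1 + v)\<close>, which
      is at most \<open>v\<close> since \<open>v > 0\<close>.\<close>
    then have "s = (v + v * v) / (1 + v)\<^sup>2"
      unfolding s_def c_def by (simp add: power_divide add_divide_distrib power2_eq_square)
    also have "\<dots> \<le> v"
      using v by (subst pos_divide_le_eq) (simp, simp add: power2_eq_square algebra_simps)
    finally show ?thesis .
  qed
  then have "(s - v) * expectation (\<lambda>\<omega>. (cmod (g k \<omega>))\<^sup>2) \<le> 0"
    by (intro mult_nonpos_nonneg) auto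
  \<comment> \<open>The complex order also asks for imaginary part 0, which holds because the total
    has been identified with a real number.\<close>
  ultimately show ?thesis
    unfolding G by (simp add: less_eq_complex_def)
qed

end
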